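(* Every two-qubit perfect entangler $U$ has quasiprobability extent $\gamma(U)\ge3$, and the bound is attained by CNOT. Hence the minimum of $\gamma$ over all two-qubit perfect entanglers is $$\gamma_{\min}^{\mathrm{PE}}=3.$$
   Context: Cartan form. Every two-qubit unitary $U\in U(4)$ can be written $U=(V_1\otimes V_2)\,U_{\mathrm d}\,(V_3\otimes V_4)$ with single-qubit unitaries $V_j$ and $U_{\mathrm d}=\exp[\mathrm i(\theta_1X\otimes X+\theta_2Y\otimes Y+\theta_3Z\otimes Z)]$, where $X,Y,Z$ are the Pauli matrices and $|\theta_3|\le\theta_2\le\theta_1\le\pi/4$. CNOT is the controlled-NOT gate, whose Cartan parameters are $(\pi/4,0,0)$. Quasiprobability extent. Write $U_{\mathrm d}=\sum_{j=0}^3u_j\,\sigma_j\otimes\sigma_j$ with $\sigma_0=\mathbb I,\sigma_1=X,\sigma_2=Y,\sigma_3=Z$, and $p_j=|u_j|^2$, so $\sum_jp_j=1$. (Intrinsically, the operator-Schmidt singular values of $U$ with respect to Hilbert--Schmidt-orthonormal local operator bases are $2\sqrt{p_j}$.) $\gamma(U)$ is the optimal gate-cutting (quasiprobability decomposition) cost of $U$; for two-qubit unitaries it is given by the known formula, taken here as its definition, $\gamma(U)=2\big(\sum_{j=0}^3\sqrt{p_j}\big)^2-1$. Perfect entangler. A two-qubit unitary $U$ is a perfect entangler if it maps at least one product state $|\psi_A\rangle|\psi_B\rangle$ to a maximally entangled two-qubit state; equivalently $C_{\max}(U)=1$, where $C_{\max}(U)=\max_{|\psi_A\rangle,|\psi_B\rangle}C(U|\psi_A\rangle|\psi_B\rangle)$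 over normalised single-qubit states and $C=2s_1s_2$ is the concurrence of a normalised two-qubit pure state with Schmidt coefficients $s_1,s_2\ge0$, $s_1^2+s_2^2=1$. *)

theory Defs
  imports "HOL-Analysis.Analysis"
begin

text \<open>
  The numeral type \<open>2\<close> indexes the computational basis of one qubit: index \<open>1\<close> stands for the
  ket 0 and index \<open>2\<close> for the ket 1. The product type \<open>2 \<times> 2\<close> indexes the basis of two qubits.
\<close>

type_synonym qubit = "complex ^ 2"
type_synonym qubit2 = "complex ^ (2 \<times> 2)"
type_synonym gate = "complex ^ 2 ^ 2"
type_synonym gate2 = "complex ^ (2 \<times> 2) ^ (2 \<times> 2)"

definition adjoint_mat :: "complex ^ 'n ^ 'm \<Rightarrow> complex ^ 'm ^ 'n" where
  "adjoint_mat A = (\<chi> i j. cnj (A $ j $ i))"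

definition unitary_mat :: "complex ^ 'n ^ 'n \<Rightarrow> bool" where
  "unitary_mat U \<longleftrightarrow> adjoint_mat U ** U = mat 1 \<and> U ** adjoint_mat U = mat 1"

definition cscale :: "complex \<Rightarrow> complex ^ 'n ^ 'm \<Rightarrow> complex ^ 'n ^ 'm" where
  "cscale c A = (\<chi> i j. c * A $ i $ j)"

definition tensor_vec :: "qubit \<Rightarrow> qubit \<Rightarrow> qubit2" where
  "tensor_vec a b = (\<chi> i. a $ fst i * b $ snd i)"

definition tensor_mat :: "gate \<Rightarrow> gate \<Rightarrow> gate2" where
  "tensor_mat A B = (\<chi> i j. A $ fst i $ fst j * B $ snd i $ snd j)"

text \<open>
  The pointwise product on \<open>complex ^ 'n ^ 'n\<close> is not the matrix product, so \<open>exp\<close> is not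
  the matrix exponential there; the latter is given by its power series.
\<close>

definition mat_exp :: "complex ^ 'n ^ 'n \<Rightarrow> complex ^ 'n ^ 'n" where
  "mat_exp A = (\<Sum>k. (1 / fact k) *\<^sub>R (((**) A ^^ k) (mat 1)))"

definition pauli_X :: gate where
  "pauli_X = vector [vector [0, 1], vector [1, 0]]"

definition pauli_Y :: gate where
  "pauli_Y = vector [vector [0, - \<i>], vector [\<i>, 0]]"

definition pauli_Z :: gate where
  "pauli_Z = vector [vector [1, 0], vector [0, - 1]]"

definition pauli :: "nat \<Rightarrow> gate" where
  "pauli j = [mat 1, pauli_X, pauli_Y, pauli_Z] ! j"

definition cartan_gate :: "real \<Rightarrow> real \<Rightarrow> real \<Rightarrow> gate2" where
  "cartan_gate \<theta>1 \<theta>2 \<theta>3 =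
     mat_exp (cscale \<i> (\<theta>1 *\<^sub>R tensor_mat pauli_X pauli_X
                       + \<theta>2 *\<^sub>R tensor_mat pauli_Y pauli_Y
                       + \<theta>3 *\<^sub>R tensor_mat pauli_Z pauli_Z))"

definition has_cartan_form :: "gate2 \<Rightarrow> real \<Rightarrow> real \<Rightarrow> real \<Rightarrow> bool" where
  "has_cartan_form U \<theta>1 \<theta>2 \<theta>3 \<longleftrightarrow>
     \<bar>\<theta>3\<bar> \<le> \<theta>2 \<and> \<theta>2 \<le> \<theta>1 \<and> \<theta>1 \<le> pi / 4 \<and>
     (\<exists>V1 V2 V3 V4. unitary_mat V1 \<and> unitary_mat V2 \<and> unitary_mat V3 \<and> unitary_mat V4 \<and>
        U = tensor_mat V1 V2 ** cartan_gate \<theta>1 \<theta>2 \<theta>3 ** tensor_mat V3 V4)"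

text \<open>
  Every two-qubit unitary has a Cartan form, and the extent computed from it does not depend on
  the form chosen, so the definite description below is meaningful for every unitary \<open>U\<close>.
\<close>

definition qp_extent :: "gate2 \<Rightarrow> real" where
  "qp_extent U =
     (THE g. \<exists>\<theta>1 \<theta>2 \<theta>3 u. has_cartan_form U \<theta>1 \<theta>2 \<theta>3 \<and>
        cartan_gate \<theta>1 \<theta>2 \<theta>3 = (\<Sum>j<4. cscale (u j) (tensor_mat (pauli j) (pauli j))) \<and>
        g = 2 * (\<Sum>j<4. sqrt ((cmod (u j))\<^sup>2))\<^sup>2 - 1)"

definition orthonormal_pair :: "qubit \<Rightarrow> qubit \<Rightarrow> bool" where
  "orthonormal_pair e f \<longleftrightarrow> norm e = 1 \<and> norm f = 1 \<and> (\<Sum>i\<in>UNIV. cnj (e $ i) * f $ i) = 0"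

definition schmidt_coeffs :: "qubit2 \<Rightarrow> real \<Rightarrow> real \<Rightarrow> bool" where
  "schmidt_coeffs \<psi> s1 s2 \<longleftrightarrow> 0 \<le> s1 \<and> 0 \<le> s2 \<and>
     (\<exists>e1 e2 f1 f2. orthonormal_pair e1 e2 \<and> orthonormal_pair f1 f2 \<and>
        \<psi> = s1 *\<^sub>R tensor_vec e1 f1 + s2 *\<^sub>R tensor_vec e2 f2)"

text \<open>
  For a normalised state, equal Schmidt coefficients \<open>1 / sqrt 2\<close> amount to concurrence
  \<open>2 * s1 * s2 = 1\<close>.
\<close>

definition maximally_entangled :: "qubit2 \<Rightarrow> bool" where
  "maximally_entangled \<psi> \<longleftrightarrow> schmidt_coeffs \<psi> (1 / sqrt 2) (1 / sqrt 2)"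

definition perfect_entangler :: "gate2 \<Rightarrow> bool" where
  "perfect_entangler U \<longleftrightarrow> unitary_mat U \<and>
     (\<exists>a b. norm a = 1 \<and> norm b = 1 \<and> maximally_entangled (U *v tensor_vec a b))"

definition CNOT :: gate2 where
  "CNOT = tensor_mat (vector [vector [1, 0], vector [0, 0]]) (mat 1)
        + tensor_mat (vector [vector [0, 0], vector [0, 1]]) pauli_X"

text \<open>
  \<open>LEAST\<close> denotes a minimum only when one exists, that is, when some perfect entangler
  attains a value that is a lower bound for all the others.
\<close>

definition qp_extent_min_PE :: real where
  "qp_extent_min_PE = (LEAST g. \<exists>U. perfect_entangler U \<and> g = qp_extent U)"

end

theory Submission
  imports Defs
begin

text \<open>
  Lower bound: if \<open>U = (A \<otimes> B) (\<Sum>j. u\<^sub>j \<sigma>\<^sub>j \<otimes> \<sigma>\<^sub>j) (C \<otimes> D)\<close> sends a product state to a maximally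
  entangled state \<open>\<psi>\<close>, then \<open>\<psi>\<close> is a combination of product states with coefficients \<open>u\<^sub>j\<close>.
  Every product state has overlap at most \<open>1 / sqrt 2\<close> with \<open>\<psi>\<close>, so \<open>1 \<le> (\<Sum>j. \<bar>u\<^sub>j\<bar>) / sqrt 2\<close>
  and the extent is at least 3.

  The extent is well defined because \<open>\<Sum>j. \<bar>u\<^sub>j\<bar>\<close> is a local invariant (half the trace norm of the
  realigned operator) and because every unitary has a Cartan form. For the latter, \<open>U\<close> becomes
  real orthogonal times diagonal times real orthogonal in the magic basis; real orthonormal frames
  of four vectors are, up to the sign of one vector, of the form \<open>p e\<^sub>a r\<close> with unit quaternions \<open>p\<close>, \<open>r\<close>,
  that is, local gates; finally the angles are moved to the chamber by permutations, pairwise sign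
  flips and shifts by \<open>pi / 2\<close>, all of which are local.
\<close>

section \<open>Common eigenbases of commuting self-adjoint maps\<close>

text \<open>A maximiser of \<open>x \<bullet> f x\<close> on the unit sphere of \<open>V\<close> is
  an eigenvector: if the residual \<open>g\<close> were nonzero, moving the maximiser against it
  would increase the Rayleigh quotient.\<close>

lemma selfadjoint_eigenvector:
  fixes f :: "'a::euclidean_space \<Rightarrow> 'a"
  assumes lin: "linear f" and sa: "\<And>x y. f x \<bullet> y = x \<bullet> f y"
    and V: "subspace V" and inv: "\<And>x. x \<in> V \<Longrightarrow> f x \<in> V" and nz: "\<exists>x\<in>V. x \<noteq> 0"
  shows "\<exists>v\<in>V. norm v = 1 \<and> (\<exists>l. f v = l *\<^sub>R v)"
proof -
  let ?S = "sphere 0 1 \<inter> V"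
  obtain x where x: "x \<in> V" "x \<noteq> 0" using nz by blast
  have "x /\<^sub>R norm x \<in> ?S" using x V by (simp add: subspace_scale)
  then have ne: "?S \<noteq> {}" by blast
  have comp: "compact ?S" by (simp add: V closed_subspace compact_Int_closed)
  have cont: "continuous_on ?S (\<lambda>x. x \<bullet> f x)"
    by (intro continuous_intros linear_continuous_on linear_conv_bounded_linear[THEN iffD1] lin)
  obtain v where v: "v \<in> ?S" and mx: "\<And>y. y \<in> ?S \<Longrightarrow> y \<bullet> f y \<le> v \<bullet> f v"
    using continuous_attains_sup[OF comp ne cont] by blast
  define l where "l = v \<bullet> f v"
  have vv: "v \<bullet> v = 1" using v by (simp add: norm_eq_1)
  have pos: "w \<bullet> f w \<le> l * (w \<bullet> w)" if w: "w \<in> V" for w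
  proof (cases "w = 0")
    case False
    have "w /\<^sub>R norm w \<in> ?S" using w False V by (simp add: subspace_scale)
    from mx[OF this] have "(w \<bullet> f w) / (norm w)^2 \<le> l"
      by (simp add: l_def linear_scale[OF lin] power2_eq_square field_simps)
    then show ?thesis using False by (simp add: divide_le_eq dot_square_norm)
  qed (simp add: linear_0[OF lin])
  define g where "g = l *\<^sub>R v - f v"
  have gV: "g \<in> V" using v V inv by (simp add: g_def subspace_diff subspace_scale)
  have gv: "g \<bullet> v = 0" by (simp add: g_def inner_diff_left inner_diff_right vv l_def inner_commute)
  have "g \<bullet> g = 0"
  proof (rule ccontr)
    assume n: "g \<bullet> g \<noteq> 0"
    define c where "c = l * (g \<bullet> g) - g \<bullet> f g"
    have c: "0 \<le> c" using pos[OF gV] by (simp add: c_def)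
    have fvg: "f v \<bullet> g = - (g \<bullet> g)"
      using gv by (simp add: g_def inner_diff_left inner_diff_right inner_commute algebra_simps vv)
    have gfv: "g \<bullet> f v = - (g \<bullet> g)" "v \<bullet> f g = - (g \<bullet> g)" "v \<bullet> g = 0"
      using fvg gv sa by (simp_all add: inner_commute)
    \<comment> \<open>This is \<open>pos\<close> at \<open>v + t *\<^sub>R g\<close>. For small
      negative \<open>t\<close> the linear term dominates; \<open>- (g \<bullet> g) / c\<close>
      minimises the right-hand side when \<open>c\<close> is positive.\<close>
    have ineq: "0 \<le> 2 * t * (g \<bullet> g) + t^2 * c" for t
    proof -
      have "v + t *\<^sub>R g \<in> V" using v gV V by (simp add: subspace_add subspace_scale)
      from pos[OF this] show ?thesis
        by (simp add: linear_add[OF lin] linear_scale[OF lin] inner_add_left inner_add_right gfv gv vv l_def c_def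
              power2_eq_square algebra_simps)
    qed
    have gp: "0 < g \<bullet> g" using n inner_ge_zero[of g] by linarith
    show False
    proof (cases "c = 0")
      case True
      then show False using ineq[of "-1"] gp by simp
    next
      case False
      then have "0 < c" using c by simp
      then show False using ineq[of "- (g \<bullet> g) / c"] mult_pos_pos[OF gp gp]
        by (simp add: power2_eq_square field_simps)
    qed
  qed
  then have "f v = l *\<^sub>R v" by (simp add: g_def)
  then show ?thesis using v by auto
qed

text \<open>By commutation \<open>g\<close> preserves the eigenspace \<open>E\<close> of
  \<open>f\<close> inside \<open>V\<close>, so an eigenvector of \<open>g\<close> found in
  \<open>E\<close> serves both maps.\<close>

lemma commuting_selfadjoint_eigenvector:
  fixes f g :: "'a::euclidean_space \<Rightarrow> 'a"
  assumes f: "linear f" "\<And>x y. f x \<bullet> y = x \<bullet> f y" and g: "linear g" "\<And>x y. g x \<bullet> y = x \<bullet> g y"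
    and comm: "\<And>x. f (g x) = g (f x)"
    and V: "subspace V" "\<And>x. x \<in> V \<Longrightarrow> f x \<in> V" "\<And>x. x \<in> V \<Longrightarrow> g x \<in> V" "\<exists>x\<in>V. x \<noteq> 0"
  shows "\<exists>v\<in>V. norm v = 1 \<and> (\<exists>l. f v = l *\<^sub>R v) \<and> (\<exists>m. g v = m *\<^sub>R v)"
proof -
  obtain v l where v: "v \<in> V" "norm v = 1" "f v = l *\<^sub>R v"
    using selfadjoint_eigenvector[OF f V(1,2,4)] by blast
  define E where "E = {x \<in> V. f x = l *\<^sub>R x}"
  have "subspace E" using V(1)
    by (auto simp: E_def subspace_def linear_0[OF f(1)] linear_add[OF f(1)] linear_scale[OF f(1)] algebra_simps)
  moreover have "g x \<in> E" if "x \<in> E" for x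
    using that V(3) by (simp add: E_def comm linear_scale[OF g(1)])
  moreover have "\<exists>x\<in>E. x \<noteq> 0" using v by (intro bexI[of _ v]) (auto simp: E_def)
  ultimately obtain w where "w \<in> E" "norm w = 1" "\<exists>m. g w = m *\<^sub>R w"
    using selfadjoint_eigenvector[OF g, of E] by blast
  then show ?thesis by (auto simp: E_def)
qed

text \<open>Induction on \<open>n\<close>: the orthogonal complement of the eigenvectors already
  found is invariant under both self-adjoint maps and is nonzero below the full dimension, so it
  supplies the next vector. For \<open>n = DIM('a)\<close> this is simultaneous
  diagonalisation.\<close>

lemma commuting_selfadjoint_orthonormal:
  fixes f g :: "'a::euclidean_space \<Rightarrow> 'a"
  assumes f: "linear f" "\<And>x y. f x \<bullet> y = x \<bullet> f y" and g: "linear g" "\<And>x y. g x \<bullet> y = x \<bullet> g y"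
    and comm: "\<And>x. f (g x) = g (f x)" and n: "n \<le> DIM('a)"
  shows "\<exists>B. finite B \<and> card B = n \<and> (\<forall>x\<in>B. \<forall>y\<in>B. x \<bullet> y = (if x = y then 1 else 0)) \<and>
    (\<forall>v\<in>B. (\<exists>l. f v = l *\<^sub>R v) \<and> (\<exists>m. g v = m *\<^sub>R v))"
  using n
proof (induction n)
  case 0
  show ?case by (rule exI[of _ "{}"]) auto
next
  case (Suc n)
  then obtain B where B: "finite B" "card B = n" "\<forall>x\<in>B. \<forall>y\<in>B. x \<bullet> y = (if x = y then 1 else 0)"
    "\<forall>v\<in>B. (\<exists>l. f v = l *\<^sub>R v) \<and> (\<exists>m. g v = m *\<^sub>R v)" by auto
  define V where "V = {x. \<forall>b\<in>B. x \<bullet> b = 0}"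
  have "dim B < DIM('a)" using dim_le_card'[OF B(1)] B(2) Suc.prems by simp
  then obtain x where "x \<noteq> 0" "\<And>y. y \<in> span B \<Longrightarrow> orthogonal x y"
    using orthogonal_to_subspace_exists by blast
  then have nz: "\<exists>x\<in>V. x \<noteq> 0" unfolding V_def orthogonal_def using span_base by blast
  have sub: "subspace V" by (auto simp: V_def subspace_def inner_add_left)
  have inv: "h x \<in> V" if "x \<in> V" "\<And>x y. h x \<bullet> y = x \<bullet> h y" "\<forall>v\<in>B. \<exists>l. h v = l *\<^sub>R v" for h x
    using that by (fastforce simp: V_def)
  obtain v where v: "v \<in> V" "norm v = 1" "\<exists>l. f v = l *\<^sub>R v" "\<exists>m. g v = m *\<^sub>R v"
    using commuting_selfadjoint_eigenvector[OF f g comm sub _ _ nz] inv[OF _ f(2)] inv[OF _ g(2)] B(4) by metis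
  have "v \<notin> B" using v B(3) by (force simp: V_def norm_eq_1)
  then show ?case using v B
    by (intro exI[of _ "insert v B"]) (auto simp: V_def norm_eq_1 inner_commute)
qed

section \<open>Quaternions and orthonormal frames\<close>

text \<open>Hamilton's product, with coordinates 1 to 4 taken along 1, i, j, k.\<close>

definition qmul :: "real^4 \<Rightarrow> real^4 \<Rightarrow> real^4" (infixl "\<odot>" 70) where
  "x \<odot> y = vector
    [x$1 * y$1 - x$2 * y$2 - x$3 * y$3 - x$4 * y$4,
     x$1 * y$2 + x$2 * y$1 + x$3 * y$4 - x$4 * y$3,
     x$1 * y$3 - x$2 * y$4 + x$3 * y$1 + x$4 * y$2,
     x$1 * y$4 + x$2 * y$3 - x$3 * y$2 + x$4 * y$1]"

definition qconj :: "real^4 \<Rightarrow> real^4" where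
  "qconj x = vector [x$1, - x$2, - x$3, - x$4]"

abbreviation qone :: "real^4" where "qone \<equiv> axis 1 1"

lemma vector_4_nth [simp]:
  "(vector [a, b, c, d] :: 'a::zero^4) $ 1 = a" "(vector [a, b, c, d] :: 'a^4) $ 2 = b"
  "(vector [a, b, c, d] :: 'a^4) $ 3 = c" "(vector [a, b, c, d] :: 'a^4) $ 4 = d"
  by (simp_all add: vector_def)

lemma qmul_nth [simp]:
  "(x \<odot> y) $ 1 = x$1 * y$1 - x$2 * y$2 - x$3 * y$3 - x$4 * y$4"
  "(x \<odot> y) $ 2 = x$1 * y$2 + x$2 * y$1 + x$3 * y$4 - x$4 * y$3"
  "(x \<odot> y) $ 3 = x$1 * y$3 - x$2 * y$4 + x$3 * y$1 + x$4 * y$2"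
  "(x \<odot> y) $ 4 = x$1 * y$4 + x$2 * y$3 - x$3 * y$2 + x$4 * y$1"
  by (simp_all add: qmul_def)

lemma qconj_nth [simp]:
  "qconj x $ 1 = x$1" "qconj x $ 2 = - x$2" "qconj x $ 3 = - x$3" "qconj x $ 4 = - x$4"
  by (simp_all add: qconj_def)

lemma vec4_eq_iff: "(x :: 'a^4) = y \<longleftrightarrow> x$1 = y$1 \<and> x$2 = y$2 \<and> x$3 = y$3 \<and> x$4 = y$4"
  by (simp add: vec_eq_iff forall_4)

lemma inner_vec4: "(x :: real^4) \<bullet> y = x$1 * y$1 + x$2 * y$2 + x$3 * y$3 + x$4 * y$4"
  by (simp add: inner_vec_def sum_4)

lemma qmul_assoc: "x \<odot> y \<odot> z = x \<odot> (y \<odot> z)"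
  by (simp add: vec4_eq_iff algebra_simps)

lemma qmul_bilinear:
  "(x + y) \<odot> z = x \<odot> z + y \<odot> z" "x \<odot> (y + z) = x \<odot> y + x \<odot> z"
  "(x - y) \<odot> z = x \<odot> z - y \<odot> z" "x \<odot> (y - z) = x \<odot> y - x \<odot> z"
  "(- x) \<odot> z = - (x \<odot> z)" "x \<odot> (- z) = - (x \<odot> z)"
  "(c *\<^sub>R x) \<odot> z = c *\<^sub>R (x \<odot> z)" "x \<odot> (c *\<^sub>R z) = c *\<^sub>R (x \<odot> z)"
  by (simp_all add: vec4_eq_iff algebra_simps)

lemma qmul_one [simp]: "qone \<odot> x = x" "x \<odot> qone = x"
  by (simp_all add: vec4_eq_iff axis_def)

lemma qconj_mult: "x \<odot> qconj x = (x \<bullet> x) *\<^sub>R qone" "qconj x \<odot> x = (x \<bullet> x) *\<^sub>R qone"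
  by (simp_all add: vec4_eq_iff inner_vec4 axis_def algebra_simps)

lemma inner_qconj: "qconj x \<bullet> qconj x = x \<bullet> x" by (simp add: inner_vec4)

text \<open>Euler's four-square identity in polarised form; multiplication by a unit quaternion is
  therefore an isometry.\<close>

lemma inner_qmul_left: "(p \<odot> x) \<bullet> (p \<odot> y) = (p \<bullet> p) * (x \<bullet> y)"
  by (simp add: inner_vec4) algebra

lemma inner_qmul_right: "(x \<odot> p) \<bullet> (y \<odot> p) = (p \<bullet> p) * (x \<bullet> y)"
  by (simp add: inner_vec4) algebra

lemma qmul_imaginary:
  assumes "x$1 = 0" "y$1 = 0"
  shows "x \<odot> y + y \<odot> x = (- 2 * (x \<bullet> y)) *\<^sub>R qone"
  using assms by (simp add: vec4_eq_iff inner_vec4 axis_def algebra_simps)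

lemma qmul_imaginary_square: "x$1 = 0 \<Longrightarrow> x \<odot> x = - (x \<bullet> x) *\<^sub>R qone"
  by (simp add: vec4_eq_iff inner_vec4 axis_def algebra_simps)

lemma axis_qmul:
  "axis 2 1 \<odot> axis 2 1 = - qone" "axis 3 1 \<odot> axis 3 1 = - qone"
  "axis 2 1 \<odot> axis 3 1 = axis 4 1" "axis 3 1 \<odot> axis 2 1 = - axis 4 1"
  "axis 2 1 \<odot> axis 4 1 = - axis 3 1" "axis 3 1 \<odot> axis 4 1 = axis 2 1"
  by (simp_all add: vec4_eq_iff axis_def)

text \<open>The intertwiner comes from averaging \<open>x\<close> over the quaternion group; the average
  is nonzero for some basis vector because the trace of the averaging map is 4.\<close>

lemma quaternion_intertwiner:
  assumes im: "a$1 = 0" "b$1 = 0" and unit: "a \<bullet> a = 1" "b \<bullet> b = 1" and orth: "a \<bullet> b = 0"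
  shows "\<exists>r. r \<bullet> r = 1 \<and> axis 2 1 \<odot> r = r \<odot> a \<and> axis 3 1 \<odot> r = r \<odot> b"
proof -
  define c where "c = a \<odot> b"
  have aa: "a \<odot> a = - qone" and bb: "b \<odot> b = - qone"
    using qmul_imaginary_square[OF im(1)] qmul_imaginary_square[OF im(2)] unit by simp_all
  have ba: "b \<odot> a = - c"
    using qmul_imaginary[OF im] orth by (simp add: c_def add_eq_0_iff)
  have ca: "c \<odot> a = b"
    using ba by (simp add: c_def qmul_assoc qmul_bilinear) (simp add: c_def qmul_assoc[symmetric] aa qmul_bilinear)
  have cb: "c \<odot> b = - a" by (simp add: c_def qmul_assoc bb qmul_bilinear)
  have c1: "c $ 1 = 0" using im orth by (simp add: c_def inner_vec4)
  \<comment> \<open>Each summand is a basis unit times \<open>x\<close> times the inverse of its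
    image under i, j, k to \<open>a\<close>, \<open>b\<close>, \<open>c\<close>. An imaginary unit
    has its negative as inverse, hence the minus signs.\<close>
  define R where "R x = x - axis 2 1 \<odot> x \<odot> a - axis 3 1 \<odot> x \<odot> b - axis 4 1 \<odot> x \<odot> c" for x
  have R1: "axis 2 1 \<odot> R x = R x \<odot> a" for x
    by (simp add: R_def qmul_bilinear qmul_assoc aa ba ca)
       (simp add: qmul_assoc[symmetric] axis_qmul qmul_bilinear)
  have R2: "axis 3 1 \<odot> R x = R x \<odot> b" for x
    by (simp add: R_def qmul_bilinear qmul_assoc bb cb c_def[symmetric])
       (simp add: qmul_assoc[symmetric] axis_qmul qmul_bilinear)
  have "R (axis 1 1) $ 1 + R (axis 2 1) $ 2 + R (axis 3 1) $ 3 + R (axis 4 1) $ 4 = 4"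
    using im c1 by (simp add: R_def axis_def)
  then obtain x where nz: "R x \<noteq> 0" by (metis add_0 zero_index zero_neq_numeral)
  have "(R x /\<^sub>R norm (R x)) \<bullet> (R x /\<^sub>R norm (R x)) = 1"
    using nz by (metis norm_eq_1 norm_sgn sgn_div_norm)
  then show ?thesis using R1 R2 nz
    by (intro exI[of _ "R x /\<^sub>R norm (R x)"]) (simp add: qmul_bilinear)
qed

text \<open>The matrix \<open>A\<close> with rows \<open>k a\<close> satisfies
  \<open>A ** transpose A = mat 1\<close>; being square, it also satisfies the reversed equation,
  which is the expansion.\<close>

lemma orthonormal_frame_expansion:
  fixes k :: "'n::finite \<Rightarrow> real^'n"
  assumes "\<And>a b. k a \<bullet> k b = (if a = b then 1 else 0)"
  shows "(\<Sum>a\<in>UNIV. (x \<bullet> k a) *\<^sub>R k a) = x"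
proof -
  define A where "A = (\<chi> a. k a)"
  have "A ** transpose A = mat 1"
    using assms by (simp add: A_def matrix_matrix_mult_def transpose_def mat_def vec_eq_iff inner_vec_def)
  then have "transpose A ** A = mat 1" using matrix_left_right_inverse by blast
  then have "transpose A *v (A *v x) = x" by (simp add: matrix_vector_mul_assoc)
  moreover have "transpose A *v (A *v x) = (\<Sum>a\<in>UNIV. (x \<bullet> k a) *\<^sub>R k a)"
    by (simp add: A_def matrix_vector_mult_def transpose_def vec_eq_iff inner_vec_def mult.commute)
  ultimately show ?thesis by simp
qed

text \<open>Dividing by \<open>k 1\<close> on the left makes the first vector 1 and the other three
  imaginary. A unit \<open>r\<close> then conjugates the second and third to i and j, and the fourth
  must be their product up to the sign \<open>s\<close>, the orientation of the frame. Undoing both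
  moves gives \<open>p = k 1 \<odot> qconj r\<close>.\<close>

lemma orthonormal_frame_quaternion:
  fixes k :: "4 \<Rightarrow> real^4"
  assumes on: "\<And>a b. k a \<bullet> k b = (if a = b then 1 else 0)"
  shows "\<exists>p r s. p \<bullet> p = 1 \<and> r \<bullet> r = 1 \<and> (s = 1 \<or> s = -1) \<and>
    (\<forall>a. k a = (if a = 4 then s else 1) *\<^sub>R (p \<odot> axis a 1 \<odot> r))"
proof -
  define N where "N a = qconj (k 1) \<odot> k a" for a
  have onN: "N a \<bullet> N b = (if a = b then 1 else 0)" for a b
    using on by (simp add: N_def inner_qmul_left inner_qconj)
  have N1: "N 1 = qone" using on by (simp add: N_def qconj_mult)
  have comp1: "x $ 1 = x \<bullet> qone" for x :: "real^4" by (simp add: inner_axis)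
  have im: "N a $ 1 = 0" if "a \<noteq> 1" for a using onN[of a 1] N1 that comp1 by simp
  obtain r where r: "r \<bullet> r = 1" "axis 2 1 \<odot> r = r \<odot> N 2" "axis 3 1 \<odot> r = r \<odot> N 3"
    using quaternion_intertwiner[OF im im onN[of 2 2, simplified] onN[of 3 3, simplified]] onN[of 2 3] by auto
  define c where "c = N 2 \<odot> N 3"
  have c: "c \<bullet> qone = 0" "c \<bullet> N 2 = 0" "c \<bullet> N 3 = 0" "c \<bullet> c = 1"
  proof -
    show "c \<bullet> qone = 0" using onN[of 2 3] im[of 2] im[of 3]
      by (simp add: c_def inner_vec4 axis_def)
    show "c \<bullet> N 2 = 0" using inner_qmul_left[of "N 2" "N 3" qone] im[of 3] by (simp add: c_def comp1)
    show "c \<bullet> N 3 = 0" using inner_qmul_right[of "N 2" "N 3" qone] im[of 2] by (simp add: c_def comp1)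
    show "c \<bullet> c = 1" using onN by (simp add: c_def inner_qmul_left)
  qed
  \<comment> \<open>By \<open>c\<close> above, the expansion in the frame \<open>N\<close> keeps
    only its fourth term.\<close>
  have ce: "c = (c \<bullet> N 4) *\<^sub>R N 4"
    using orthonormal_frame_expansion[of N c, OF onN] c N1 by (simp add: sum_4)
  define s where "s = c \<bullet> N 4"
  have "s * s = 1" using c(4) ce onN[of 4 4] by (metis inner_scaleR_right s_def)
  then have s: "s = 1 \<or> s = -1" by (simp add: square_eq_1_iff)
  then have N4: "N 4 = s *\<^sub>R c" using ce s_def by auto
  have r4: "axis 4 1 \<odot> r = r \<odot> c"
    by (metis axis_qmul(3) c_def qmul_assoc r(2,3))
  have rr: "qconj r \<odot> r = qone" using r(1) by (simp add: qconj_mult)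
  have conj: "qconj r \<odot> (r \<odot> x) = x" for x using rr by (simp add: qmul_assoc[symmetric])
  have kk: "k 1 \<odot> N a = k a" for a
    using on[of 1 1] by (simp add: N_def qmul_assoc[symmetric] qconj_mult)
  have "k a = (if a = 4 then s else 1) *\<^sub>R (k 1 \<odot> qconj r \<odot> axis a 1 \<odot> r)" for a
  proof -
    consider "a = 1" | "a = 2" | "a = 3" | "a = 4" using exhaust_4 by blast
    then show ?thesis
    proof cases
      case 1
      then show ?thesis using rr by (simp add: qmul_assoc)
    next
      case 2
      then show ?thesis using kk[of 2] by (simp add: qmul_assoc r conj)
    next
      case 3
      then show ?thesis using kk[of 3] by (simp add: qmul_assoc r conj)
    next
      case 4
      then show ?thesis using kk[of 4] by (simp add: qmul_assoc r4 conj N4 qmul_bilinear)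
    qed
  qed
  moreover have "(k 1 \<odot> qconj r) \<bullet> (k 1 \<odot> qconj r) = 1"
    using on r(1) by (simp add: inner_qmul_left inner_qconj)
  ultimately show ?thesis using r(1) s by blast
qed

section \<open>Pauli coefficients under local gates\<close>

lemma adjoint_mat_mult: "adjoint_mat (A ** B) = adjoint_mat B ** adjoint_mat A"
  by (simp add: adjoint_mat_def matrix_matrix_mult_def vec_eq_iff mult.commute)

lemma adjoint_mat_adjoint_mat [simp]: "adjoint_mat (adjoint_mat A) = A"
  by (simp add: adjoint_mat_def vec_eq_iff)

lemma adjoint_mat_mat_1 [simp]: "adjoint_mat (mat 1) = mat 1"
  by (simp add: adjoint_mat_def mat_def vec_eq_iff)

lemma unitary_mat_mat_1 [simp]: "unitary_mat (mat 1)"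
  by (simp add: unitary_mat_def)

lemma unitary_mat_adjoint: "unitary_mat U \<Longrightarrow> unitary_mat (adjoint_mat U)"
  by (simp add: unitary_mat_def)

lemma unitary_mat_mult:
  assumes "unitary_mat U" "unitary_mat V"
  shows "unitary_mat (U ** V)"
proof -
  have "adjoint_mat V ** adjoint_mat U ** (U ** V) = adjoint_mat V ** (adjoint_mat U ** U) ** V"
    "U ** V ** (adjoint_mat V ** adjoint_mat U) = U ** (V ** adjoint_mat V) ** adjoint_mat U"
    by (simp_all only: matrix_mul_assoc)
  then show ?thesis using assms by (simp add: unitary_mat_def adjoint_mat_mult)
qed

lemma unitary_matI: "adjoint_mat U ** U = mat 1 \<Longrightarrow> unitary_mat U"
  using matrix_left_right_inverse unfolding unitary_mat_def by blast

lemma cscale_mult: "cscale c A ** B = cscale c (A ** B)" "A ** cscale c B = cscale c (A ** B)"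
  by (simp_all add: cscale_def matrix_matrix_mult_def vec_eq_iff sum_distrib_left ac_simps)

lemma cscale_cscale: "cscale a (cscale b A) = cscale (a * b) A"
  by (simp add: cscale_def vec_eq_iff)

lemma cscale_one [simp]: "cscale 1 A = A"
  by (simp add: cscale_def vec_eq_iff)

lemma cscale_add_left: "cscale (a + b) A = cscale a A + cscale b A"
  by (simp_all add: cscale_def vec_eq_iff algebra_simps)

lemma cscale_sum: "cscale c (\<Sum>i\<in>I. f i) = (\<Sum>i\<in>I. cscale c (f i))"
  by (simp add: cscale_def vec_eq_iff sum_distrib_left)

lemma adjoint_mat_cscale: "adjoint_mat (cscale c A) = cscale (cnj c) (adjoint_mat A)"
  by (simp add: adjoint_mat_def cscale_def vec_eq_iff)

lemma unitary_mat_cscale: "cmod c = 1 \<Longrightarrow> unitary_mat A \<Longrightarrow> unitary_mat (cscale c A)"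
  by (simp add: unitary_mat_def adjoint_mat_cscale cscale_mult cscale_cscale complex_norm_square[symmetric] mult.commute)

lemma matrix_mult_sum: "A ** (\<Sum>i\<in>I. f i) = (\<Sum>i\<in>I. A ** f i)" "(\<Sum>i\<in>I. f i) ** A = (\<Sum>i\<in>I. f i ** A)"
  for A :: "complex^'n::finite^'n"
  by (simp_all add: matrix_matrix_mult_def vec_eq_iff sum_distrib_left sum_distrib_right sum.swap[of _ UNIV I])

lemma matrix_vector_mult_sum: "(\<Sum>i\<in>I. f i) *v x = (\<Sum>i\<in>I. f i *v x)"
  by (induction I rule: infinite_finite_induct) (simp_all add: matrix_vector_mult_add_rdistrib)

lemma cscale_matrix_vector_mult: "cscale c A *v x = c *s (A *v x)"
  by (simp add: cscale_def matrix_vector_mult_def vec_eq_iff sum_distrib_left ac_simps)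

lemma sum_cnj_mult_self: "(\<Sum>i\<in>UNIV. cnj (y$i) * y$i) = complex_of_real ((norm y)\<^sup>2)" for y :: "complex^'n"
  by (simp add: norm_vec_def L2_set_def sum_nonneg complex_norm_square mult.commute del: of_real_power)

lemma norm_unitary_mat:
  assumes "unitary_mat U"
  shows "norm (U *v x) = norm x"
proof -
  have "(\<Sum>i\<in>UNIV. cnj ((U *v x)$i) * (U *v x)$i)
      = (\<Sum>i\<in>UNIV. \<Sum>j\<in>UNIV. \<Sum>k\<in>UNIV. cnj (U$i$j) * cnj (x$j) * (U$i$k * x$k))"
    by (simp add: matrix_vector_mult_def sum_product)
  also have "\<dots> = (\<Sum>j\<in>UNIV. \<Sum>k\<in>UNIV. \<Sum>i\<in>UNIV. cnj (U$i$j) * cnj (x$j) * (U$i$k * x$k))"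
    by (subst sum.swap) (intro sum.cong refl sum.swap)
  also have "\<dots> = (\<Sum>j\<in>UNIV. \<Sum>k\<in>UNIV. cnj (x$j) * ((adjoint_mat U ** U)$j$k * x$k))"
    by (simp add: adjoint_mat_def matrix_matrix_mult_def sum_distrib_left sum_distrib_right ac_simps)
  also have "\<dots> = (\<Sum>j\<in>UNIV. cnj (x$j) * x$j)"
    using assms by (simp add: unitary_mat_def mat_def if_distrib if_distribR cong: if_cong)
  finally have "(norm (U *v x))\<^sup>2 = (norm x)\<^sup>2" by (simp only: sum_cnj_mult_self of_real_eq_iff)
  then show ?thesis by simp
qed

lemma sum_prod_UNIV: "(\<Sum>i\<in>(UNIV :: ('a::finite \<times> 'b::finite) set). f i) = (\<Sum>a\<in>UNIV. \<Sum>b\<in>UNIV. f (a, b))"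
  by (simp add: UNIV_Times_UNIV[symmetric] sum.cartesian_product del: UNIV_Times_UNIV)

lemma tensor_mat_mult: "tensor_mat A B ** tensor_mat C D = tensor_mat (A ** C) (B ** D)"
  by (simp add: tensor_mat_def matrix_matrix_mult_def vec_eq_iff sum_prod_UNIV sum_product ac_simps)

lemma tensor_mat_vec: "tensor_mat A B *v tensor_vec a b = tensor_vec (A *v a) (B *v b)"
  by (simp add: tensor_mat_def tensor_vec_def matrix_vector_mult_def vec_eq_iff sum_prod_UNIV sum_product ac_simps)

lemma adjoint_tensor_mat: "adjoint_mat (tensor_mat A B) = tensor_mat (adjoint_mat A) (adjoint_mat B)"
  by (simp add: tensor_mat_def adjoint_mat_def vec_eq_iff)

lemma tensor_mat_1 [simp]: "tensor_mat (mat 1) (mat 1) = mat 1"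
  by (auto simp: tensor_mat_def mat_def vec_eq_iff prod_eq_iff)

lemma unitary_tensor_mat: "unitary_mat A \<Longrightarrow> unitary_mat B \<Longrightarrow> unitary_mat (tensor_mat A B)"
  by (simp add: unitary_mat_def adjoint_tensor_mat tensor_mat_mult)

lemma cscale_tensor_mat: "cscale c (tensor_mat A B) = tensor_mat (cscale c A) B"
  by (simp add: cscale_def tensor_mat_def vec_eq_iff ac_simps)

section \<open>Expansion in the Pauli basis\<close>

lemma pauli_nth [simp]:
  "pauli 0 = mat 1" "pauli (Suc 0) = pauli_X" "pauli 2 = pauli_Y" "pauli 3 = pauli_Z"
  by (simp_all add: pauli_def numeral_eq_Suc)

lemma sum_lessThan_4: "(\<Sum>j<4. f j) = f 0 + f (Suc 0) + f 2 + f (3::nat)"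
  by (simp add: numeral_eq_Suc)

lemma less_4_cases: "j < 4 \<Longrightarrow> j = 0 \<or> j = Suc 0 \<or> j = 2 \<or> j = (3::nat)"
  by auto

lemmas pauli_defs = pauli_X_def pauli_Y_def pauli_Z_def

lemma unitary_pauli: "j < 4 \<Longrightarrow> unitary_mat (pauli j)"
  by (auto dest!: less_4_cases intro!: unitary_matI
      simp: adjoint_mat_def mat_def matrix_matrix_mult_def vec_eq_iff forall_2 sum_2 pauli_defs)

text \<open>The Pauli matrices are self-adjoint and orthogonal with squared trace norm 2, so this is
  the coordinate of \<open>M\<close> along \<open>pauli j\<close>.\<close>

definition pauli_coeff :: "nat \<Rightarrow> gate \<Rightarrow> complex" where
  "pauli_coeff j M = trace (pauli j ** M) / 2"

lemma pauli_coeff_pauli: "j < 4 \<Longrightarrow> k < 4 \<Longrightarrow> pauli_coeff j (pauli k) = (if j = k then 1 else 0)"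
  by (auto dest!: less_4_cases
      simp: pauli_coeff_def trace_def mat_def matrix_matrix_mult_def sum_2 pauli_defs)

text \<open>The sum is half the sum of the squared moduli of the entries of \<open>M\<close>, and
  each of the two columns contributes 1.\<close>

lemma pauli_coeff_parseval:
  assumes "unitary_mat M"
  shows "(\<Sum>j<4. (cmod (pauli_coeff j M))\<^sup>2) = 1"
proof -
  have 1: "cnj (M$1$1) * M$1$1 + cnj (M$2$1) * M$2$1 = 1" "cnj (M$1$2) * M$1$2 + cnj (M$2$2) * M$2$2 = 1"
    using assms
    by (simp_all add: unitary_mat_def adjoint_mat_def matrix_matrix_mult_def mat_def vec_eq_iff forall_2 sum_2)
  have "complex_of_real (\<Sum>j<4. (cmod (pauli_coeff j M))\<^sup>2) =
    ((cnj (M$1$1) * M$1$1 + cnj (M$2$1) * M$2$1) + (cnj (M$1$2) * M$1$2 + cnj (M$2$2) * M$2$2)) / 2"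
    by (simp add: sum_lessThan_4 complex_norm_square pauli_coeff_def trace_def mat_def
        matrix_matrix_mult_def sum_2 pauli_defs field_simps del: of_real_power)
  then have "complex_of_real (\<Sum>j<4. (cmod (pauli_coeff j M))\<^sup>2) = complex_of_real 1"
    by (simp only: 1) simp
  then show ?thesis by (simp only: of_real_eq_iff)
qed

text \<open>Only coordinates along equal pairs \<sigma>_j \<otimes> \<sigma>_j are extracted, the
  ones that occur in \<open>pauli_diag\<close>.\<close>

definition pauli_coeff2 :: "nat \<Rightarrow> gate2 \<Rightarrow> complex" where
  "pauli_coeff2 j T = trace (tensor_mat (pauli j) (pauli j) ** T) / 4"

lemma pauli_coeff2_tensor: "pauli_coeff2 j (tensor_mat A B) = pauli_coeff j A * pauli_coeff j B"
  unfolding pauli_coeff2_def pauli_coeff_def tensor_mat_mult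
  by (simp add: trace_def tensor_mat_def sum_prod_UNIV sum_product)

lemma trace_cscale: "trace (cscale c A) = c * trace A"
  by (simp add: trace_def cscale_def sum_distrib_left)

lemma trace_sum: "trace (\<Sum>i\<in>I. f i) = (\<Sum>i\<in>I. trace (f i :: complex^'n::finite^'n))"
  unfolding trace_def by (simp add: sum.swap[of _ UNIV I])

lemma pauli_coeff2_sum: "pauli_coeff2 j (\<Sum>k<4. cscale (u k) (T k)) = (\<Sum>k<4. u k * pauli_coeff2 j (T k))"
  by (simp add: pauli_coeff2_def matrix_mult_sum cscale_mult trace_sum trace_cscale sum_divide_distrib)

definition pauli_diag :: "(nat \<Rightarrow> complex) \<Rightarrow> gate2" where
  "pauli_diag u = (\<Sum>j<4. cscale (u j) (tensor_mat (pauli j) (pauli j)))"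

lemma local_pauli_diag_local:
  "tensor_mat A B ** pauli_diag u ** tensor_mat C D =
   (\<Sum>k<4. cscale (u k) (tensor_mat (A ** pauli k ** C) (B ** pauli k ** D)))"
  by (simp add: pauli_diag_def matrix_mult_sum cscale_mult tensor_mat_mult)

lemma pauli_coeff2_pauli_diag: "j < 4 \<Longrightarrow> pauli_coeff2 j (pauli_diag u) = u j"
  unfolding pauli_diag_def pauli_coeff2_sum
  by (auto simp: pauli_coeff2_tensor pauli_coeff_pauli sum_lessThan_4 dest!: less_4_cases)

lemma mult_le_mean_squares: "x * y \<le> (x\<^sup>2 + y\<^sup>2) / 2" for x y :: real
  using sum_squares_bound[of x y] by (simp add: mult.assoc)

lemma cauchy_schwarz_unit:
  fixes f g :: "'a \<Rightarrow> real"
  assumes "(\<Sum>i\<in>I. (f i)\<^sup>2) = 1" "(\<Sum>i\<in>I. (g i)\<^sup>2) = 1"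
  shows "(\<Sum>i\<in>I. f i * g i) \<le> 1"
proof -
  have "(\<Sum>i\<in>I. f i * g i) \<le> (\<Sum>i\<in>I. ((f i)\<^sup>2 + (g i)\<^sup>2) / 2)"
    by (intro sum_mono mult_le_mean_squares)
  also have "\<dots> = 1" using assms by (simp add: sum_divide_distrib[symmetric] sum.distrib)
  finally show ?thesis .
qed

text \<open>The matrices \<open>P\<^sub>j\<^sub>k = pauli_coeff j (A \<sigma>\<^sub>k C)\<close> and their analogues for \<open>B\<close>, \<open>D\<close>
  have unit columns, so the sum of moduli cannot grow.\<close>

lemma pauli_diag_local_le:
  assumes un: "unitary_mat A" "unitary_mat B" "unitary_mat C" "unitary_mat D"
    and eq: "pauli_diag v = tensor_mat A B ** pauli_diag u ** tensor_mat C D"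
  shows "(\<Sum>j<4. cmod (v j)) \<le> (\<Sum>j<4. cmod (u j))"
proof -
  define P where "P j k = pauli_coeff j (A ** pauli k ** C)" for j k
  define Q where "Q j k = pauli_coeff j (B ** pauli k ** D)" for j k
  have P1: "(\<Sum>j<4. (cmod (P j k))\<^sup>2) = 1" and Q1: "(\<Sum>j<4. (cmod (Q j k))\<^sup>2) = 1" if "k < 4" for k
    using that un unitary_pauli by (simp_all add: P_def Q_def pauli_coeff_parseval unitary_mat_mult)
  have v: "v j = (\<Sum>k<4. u k * (P j k * Q j k))" if "j < 4" for j
    using pauli_coeff2_pauli_diag[OF that, of v]
    by (simp add: eq local_pauli_diag_local pauli_coeff2_sum pauli_coeff2_tensor P_def Q_def)
  have "(\<Sum>j<4. cmod (v j)) \<le> (\<Sum>j<4. \<Sum>k<4. cmod (u k) * (cmod (P j k) * cmod (Q j k)))"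
    by (intro sum_mono) (simp add: v norm_mult[symmetric] norm_sum)
  also have "\<dots> = (\<Sum>k<4. cmod (u k) * (\<Sum>j<4. cmod (P j k) * cmod (Q j k)))"
    by (subst sum.swap) (simp add: sum_distrib_left)
  also have "\<dots> \<le> (\<Sum>k<4. cmod (u k))"
    by (intro sum_mono mult_left_le cauchy_schwarz_unit P1 Q1) auto
  finally show ?thesis .
qed

section \<open>Independence of the extent from the chosen Cartan form\<close>

lemma unitary_conjugate_solve:
  assumes "unitary_mat A" "unitary_mat B" "A ** X ** B = A' ** Y ** B'"
  shows "X = (adjoint_mat A ** A') ** Y ** (B' ** adjoint_mat B)"
proof -
  have "X = (adjoint_mat A ** A) ** X ** (B ** adjoint_mat B)"
    using assms by (simp add: unitary_mat_def)
  also have "\<dots> = adjoint_mat A ** (A ** X ** B) ** adjoint_mat B" by (simp add: matrix_mul_assoc)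
  finally show ?thesis by (simp add: assms(3) matrix_mul_assoc)
qed

text \<open>Moving the local unitaries around \<open>v\<close> to the other side reduces this to
  \<open>pauli_diag_local_le\<close>. The assumptions are symmetric in \<open>u\<close> and
  \<open>v\<close>, so two applications give equality.\<close>

lemma pauli_diag_local_eq:
  assumes un: "unitary_mat A" "unitary_mat B" "unitary_mat C" "unitary_mat D"
      "unitary_mat A'" "unitary_mat B'" "unitary_mat C'" "unitary_mat D'"
    and eq: "tensor_mat A B ** pauli_diag v ** tensor_mat C D = tensor_mat A' B' ** pauli_diag u ** tensor_mat C' D'"
  shows "(\<Sum>j<4. cmod (v j)) \<le> (\<Sum>j<4. cmod (u j))"
  using unitary_conjugate_solve[OF _ _ eq] un
  by (intro pauli_diag_local_le[of "adjoint_mat A ** A'" "adjoint_mat B ** B'" "C' ** adjoint_mat C" "D' ** adjoint_mat D"])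
    (simp_all add: unitary_mat_mult unitary_mat_adjoint unitary_tensor_mat adjoint_tensor_mat tensor_mat_mult)

text \<open>Resolves the definite description: any two Cartan forms of \<open>U\<close> have the
  same sum of moduli, so one known form evaluates the extent.\<close>

lemma qp_extent_eq:
  assumes cf: "has_cartan_form U \<theta>1 \<theta>2 \<theta>3" and u: "cartan_gate \<theta>1 \<theta>2 \<theta>3 = pauli_diag u"
  shows "qp_extent U = 2 * (\<Sum>j<4. cmod (u j))\<^sup>2 - 1"
  unfolding qp_extent_def pauli_diag_def[symmetric]
proof (rule the_equality)
  show "\<exists>\<theta>1 \<theta>2 \<theta>3 v. has_cartan_form U \<theta>1 \<theta>2 \<theta>3 \<and> cartan_gate \<theta>1 \<theta>2 \<theta>3 = pauli_diag v \<and>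
      2 * (\<Sum>j<4. cmod (u j))\<^sup>2 - 1 = 2 * (\<Sum>j<4. sqrt ((cmod (v j))\<^sup>2))\<^sup>2 - 1"
    using assms by (intro exI[of _ \<theta>1] exI[of _ \<theta>2] exI[of _ \<theta>3] exI[of _ u]) simp
next
  fix g assume "\<exists>\<theta>1 \<theta>2 \<theta>3 v. has_cartan_form U \<theta>1 \<theta>2 \<theta>3 \<and> cartan_gate \<theta>1 \<theta>2 \<theta>3 = pauli_diag v \<and>
      g = 2 * (\<Sum>j<4. sqrt ((cmod (v j))\<^sup>2))\<^sup>2 - 1"
  then obtain \<theta>1' \<theta>2' \<theta>3' v where v: "has_cartan_form U \<theta>1' \<theta>2' \<theta>3'" "cartan_gate \<theta>1' \<theta>2' \<theta>3' = pauli_diag v"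
      "g = 2 * (\<Sum>j<4. cmod (v j))\<^sup>2 - 1" by auto
  obtain A B C D where "unitary_mat A" "unitary_mat B" "unitary_mat C" "unitary_mat D"
      "U = tensor_mat A B ** pauli_diag u ** tensor_mat C D"
    using cf u unfolding has_cartan_form_def by metis
  moreover obtain A' B' C' D' where "unitary_mat A'" "unitary_mat B'" "unitary_mat C'" "unitary_mat D'"
      "U = tensor_mat A' B' ** pauli_diag v ** tensor_mat C' D'"
    using v(1,2) unfolding has_cartan_form_def by metis
  ultimately have "(\<Sum>j<4. cmod (v j)) = (\<Sum>j<4. cmod (u j))"
    by (metis antisym pauli_diag_local_eq)
  then show "g = 2 * (\<Sum>j<4. cmod (u j))\<^sup>2 - 1" using v(3) by simp
qed

section \<open>Overlaps of product states with a maximally entangled state\<close>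

lemma orthonormal_pair_parseval:
  assumes "orthonormal_pair e1 e2" "norm x = 1"
  shows "(cmod (\<Sum>i\<in>UNIV. cnj (e1$i) * x$i))\<^sup>2 + (cmod (\<Sum>i\<in>UNIV. cnj (e2$i) * x$i))\<^sup>2 = 1"
proof -
  \<comment> \<open>The conjugated vectors of the pair are the rows of a unitary, which preserves
    the norm of \<open>x\<close>.\<close>
  define E :: gate where "E = vector [\<chi> i. cnj (e1$i), \<chi> i. cnj (e2$i)]"
  have n: "(\<Sum>i\<in>UNIV. cnj (y$i) * y$i) = 1" if "norm y = 1" for y :: qubit
    using that by (simp add: sum_cnj_mult_self)
  have o: "(\<Sum>i\<in>UNIV. cnj (e2$i) * e1$i) = cnj (\<Sum>i\<in>UNIV. cnj (e1$i) * e2$i)"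
    by (simp add: mult.commute)
  have "E ** adjoint_mat E = mat 1"
    using n[of e1] n[of e2] assms o
    by (simp add: E_def orthonormal_pair_def adjoint_mat_def matrix_matrix_mult_def mat_def vec_eq_iff forall_2 sum_2 mult.commute)
  then have "unitary_mat E" using unitary_matI[of "adjoint_mat E"] unitary_mat_adjoint[of "adjoint_mat E"] by simp
  from norm_unitary_mat[OF this, of x] have "norm (E *v x) = 1" using assms by simp
  then show ?thesis
    by (simp add: norm_vec_def L2_set_def sum_2 E_def matrix_vector_mult_def)
qed

text \<open>The linear functional \<open>F\<close> takes the value \<open>sqrt 2\<close> at the
  entangled state but has modulus at most 1 on normalised product states; the triangle inequality
  compares the two.\<close>

lemma pauli_sum_ge_sqrt2:
  fixes u :: "nat \<Rightarrow> complex"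
  assumes me: "maximally_entangled (\<Sum>k<4. u k *s tensor_vec (x k) (y k))"
    and x: "\<And>k. k < 4 \<Longrightarrow> norm (x k) = 1" and y: "\<And>k. k < 4 \<Longrightarrow> norm (y k) = 1"
  shows "sqrt 2 \<le> (\<Sum>k<4. cmod (u k))"
proof -
  define ip where "ip a b = (\<Sum>i\<in>UNIV. cnj (a$i) * b$i)" for a b :: qubit
  define \<psi> where "\<psi> = (\<Sum>k<4. u k *s tensor_vec (x k) (y k))"
  obtain e1 e2 f1 f2 where e: "orthonormal_pair e1 e2" and f: "orthonormal_pair f1 f2"
    and \<psi>: "\<psi> = (1 / sqrt 2) *\<^sub>R tensor_vec e1 f1 + (1 / sqrt 2) *\<^sub>R tensor_vec e2 f2"
    using me unfolding maximally_entangled_def schmidt_coeffs_def \<psi>_def by blast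
  \<comment> \<open>\<open>F\<close> is \<open>sqrt 2\<close> times the inner product with \<psi>,
    written through the Schmidt vectors.\<close>
  define F where "F z = (\<Sum>i\<in>UNIV. cnj (e1$fst i * f1$snd i) * z$i) + (\<Sum>i\<in>UNIV. cnj (e2$fst i * f2$snd i) * z$i)"
    for z :: qubit2
  have Flin: "F (a + b) = F a + F b" "F (c *s a) = c * F a" "F 0 = 0" for a b c
    by (simp_all add: F_def sum.distrib sum_distrib_left algebra_simps)
  have Fsum: "F (\<Sum>k\<in>K. u k *s g k) = (\<Sum>k\<in>K. u k * F (g k))" for K and g :: "nat \<Rightarrow> qubit2"
    by (induction K rule: infinite_finite_induct) (simp_all add: Flin)
  have Ft: "F (tensor_vec a b) = ip e1 a * ip f1 b + ip e2 a * ip f2 b" for a b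
    by (simp add: F_def ip_def tensor_vec_def sum_prod_UNIV sum_product ac_simps)
  have Fle: "cmod (F (tensor_vec a b)) \<le> 1" if "norm a = 1" "norm b = 1" for a b
  proof -
    have "cmod (F (tensor_vec a b)) \<le> cmod (ip e1 a) * cmod (ip f1 b) + cmod (ip e2 a) * cmod (ip f2 b)"
      unfolding Ft by (metis norm_mult norm_triangle_ineq)
    also have "\<dots> \<le> ((cmod (ip e1 a))\<^sup>2 + (cmod (ip f1 b))\<^sup>2) / 2 + ((cmod (ip e2 a))\<^sup>2 + (cmod (ip f2 b))\<^sup>2) / 2"
      by (intro add_mono mult_le_mean_squares)
    also have "\<dots> = 1"
      using orthonormal_pair_parseval[OF e that(1)] orthonormal_pair_parseval[OF f that(2)]
      by (simp add: ip_def field_simps)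
    finally show ?thesis .
  qed
  have ip1: "ip a a = 1" if "norm a = 1" for a
    using that by (simp add: ip_def sum_cnj_mult_self)
  have sc: "r *\<^sub>R z = complex_of_real r *s z" for r and z :: qubit2
    by (simp add: vec_eq_iff scaleR_conv_of_real[where 'a=complex])
  have "ip e2 e1 = cnj (ip e1 e2)" "ip f2 f1 = cnj (ip f1 f2)" by (simp_all add: ip_def mult.commute)
  then have "F \<psi> = complex_of_real (2 / sqrt 2)"
    using e f ip1 unfolding \<psi> sc Flin Ft
    by (simp add: orthonormal_pair_def ip_def[symmetric])
  then have "cmod (F \<psi>) = sqrt 2" by (simp add: norm_divide real_div_sqrt)
  moreover have "cmod (F \<psi>) \<le> (\<Sum>k<4. cmod (u k) * cmod (F (tensor_vec (x k) (y k))))"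
    unfolding \<psi>_def Fsum by (metis (no_types, lifting) norm_mult norm_sum sum.cong)
  moreover have "\<dots> \<le> (\<Sum>k<4. cmod (u k))"
    by (intro sum_mono mult_left_le Fle x y) auto
  ultimately show ?thesis by linarith
qed

text \<open>Each \<open>A ** pauli k ** C\<close> and \<open>B ** pauli k ** D\<close> is unitary,
  so every term of \<open>U\<close> sends the product input to a normalised product state and
  \<open>pauli_sum_ge_sqrt2\<close> applies.\<close>

lemma perfect_entangler_pauli_diag:
  assumes pe: "perfect_entangler U" and U: "U = tensor_mat A B ** pauli_diag u ** tensor_mat C D"
    and un: "unitary_mat A" "unitary_mat B" "unitary_mat C" "unitary_mat D"
  shows "sqrt 2 \<le> (\<Sum>j<4. cmod (u j))"
proof -
  obtain a b where ab: "norm a = 1" "norm b = 1" and me: "maximally_entangled (U *v tensor_vec a b)"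
    using pe unfolding perfect_entangler_def by blast
  have "U *v tensor_vec a b =
      (\<Sum>k<4. u k *s tensor_vec ((A ** pauli k ** C) *v a) ((B ** pauli k ** D) *v b))"
    by (simp add: U local_pauli_diag_local matrix_vector_mult_sum cscale_matrix_vector_mult tensor_mat_vec)
  then show ?thesis
    using me ab un unitary_pauli
    by (intro pauli_sum_ge_sqrt2[of u "\<lambda>k. (A ** pauli k ** C) *v a" "\<lambda>k. (B ** pauli k ** D) *v b"])
      (simp_all add: norm_unitary_mat unitary_mat_mult)
qed

section \<open>The Cartan gate in the Bell basis\<close>

lemma bounded_linear_cscale: "bounded_linear (\<lambda>c. cscale c A)"
proof -
  have "linear (\<lambda>c. cscale c A)"
    by (rule linearI) (simp_all add: cscale_def vec_eq_iff algebra_simps)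
  then show ?thesis by (rule linear_conv_bounded_linear[THEN iffD1])
qed

text \<open>Multiplying the resolution of the identity by \<open>A\<close> repeatedly scales
  \<open>P a\<close> by powers of \<open>l a\<close>, so the matrix series splits into scalar
  exponential series.\<close>

lemma mat_exp_spectral:
  fixes A :: "complex^'n::finite^'n"
  assumes one: "(\<Sum>a\<in>I. P a) = mat 1" and eig: "\<And>a. a \<in> I \<Longrightarrow> A ** P a = cscale (l a) (P a)"
  shows "mat_exp A = (\<Sum>a\<in>I. cscale (exp (l a)) (P a))"
proof -
  have pow: "((**) A ^^ k) (mat 1) = (\<Sum>a\<in>I. cscale (l a ^ k) (P a))" for k
    by (induction k) (simp_all add: one matrix_mult_sum cscale_mult eig cscale_cscale ac_simps)
  have "(1 / fact k) *\<^sub>R (((**) A ^^ k) (mat 1)) = (\<Sum>a\<in>I. cscale (l a ^ k /\<^sub>R fact k) (P a))" for k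
    by (simp add: pow scaleR_sum_right cscale_def vec_eq_iff divide_inverse)
  moreover have "(\<lambda>k. \<Sum>a\<in>I. cscale (l a ^ k /\<^sub>R fact k) (P a)) sums (\<Sum>a\<in>I. cscale (exp (l a)) (P a))"
    by (intro sums_sum bounded_linear.sums[OF bounded_linear_cscale] exp_converges)
  ultimately show ?thesis by (simp add: mat_exp_def sums_iff)
qed

text \<open>The eigenvalue of \<open>\<sigma>\<^sub>j \<otimes> \<sigma>\<^sub>j\<close> on the Bell state number \<open>a\<close>, where the Bell states are
  ordered as \<open>00 + 11\<close>, \<open>01 + 10\<close>, \<open>01 - 10\<close>, \<open>00 - 11\<close>.\<close>

definition bell_sign :: "4 \<Rightarrow> nat \<Rightarrow> real" where
  "bell_sign a j = (if a = 1 then [1, 1, -1, 1] else if a = 2 then [1, 1, 1, -1]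
     else if a = 3 then [1, -1, -1, -1] else [1, -1, 1, 1]) ! j"

lemma bell_sign_simps [simp]:
  "bell_sign a 0 = 1"
  "bell_sign 1 (Suc 0) = 1" "bell_sign 1 2 = -1" "bell_sign 1 3 = 1"
  "bell_sign 2 (Suc 0) = 1" "bell_sign 2 2 = 1" "bell_sign 2 3 = -1"
  "bell_sign 3 (Suc 0) = -1" "bell_sign 3 2 = -1" "bell_sign 3 3 = -1"
  "bell_sign 4 (Suc 0) = -1" "bell_sign 4 2 = 1" "bell_sign 4 3 = 1"
  by (simp_all add: bell_sign_def)

text \<open>The rank-one projector onto Bell state \<open>a\<close>, given by its Pauli expansion:
  the coefficient along \<sigma>_j \<otimes> \<sigma>_j is the eigenvalue there divided by
  4.\<close>

definition bell_proj :: "4 \<Rightarrow> gate2" where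
  "bell_proj a = pauli_diag (\<lambda>j. of_real (bell_sign a j) / 4)"

definition bell_phase :: "real \<Rightarrow> real \<Rightarrow> real \<Rightarrow> 4 \<Rightarrow> real" where
  "bell_phase \<theta>1 \<theta>2 \<theta>3 a = bell_sign a 1 * \<theta>1 + bell_sign a 2 * \<theta>2 + bell_sign a 3 * \<theta>3"

lemma mat2_nth: "(mat c :: 'a::zero^2^2)$1$1 = c" "(mat c :: 'a::zero^2^2)$1$2 = 0"
    "(mat c :: 'a::zero^2^2)$2$1 = 0" "(mat c :: 'a::zero^2^2)$2$2 = c"
  by (simp_all add: mat_def)

lemmas gate2_entries = vec_eq_iff split_paired_All forall_2 matrix_matrix_mult_def sum_prod_UNIV sum_2
  cscale_def tensor_mat_def mat2_nth pauli_defs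

lemma sum_bell_proj: "(\<Sum>a\<in>UNIV. bell_proj a) = mat 1"
  unfolding bell_proj_def pauli_diag_def sum_lessThan_4 pauli_nth sum_4
  by (simp add: gate2_entries) (simp add: mat_def)

lemma pauli_tensor_bell_proj:
  assumes "j < 4"
  shows "tensor_mat (pauli j) (pauli j) ** bell_proj a = cscale (of_real (bell_sign a j)) (bell_proj a)"
proof -
  consider "a = 1" | "a = 2" | "a = 3" | "a = 4" using exhaust_4 by blast
  then show ?thesis
    using less_4_cases[OF assms]
    unfolding bell_proj_def pauli_diag_def sum_lessThan_4 pauli_nth
    by cases (elim disjE; simp add: gate2_entries)+
qed

lemma cartan_generator_bell_proj:
  "cscale \<i> (\<theta>1 *\<^sub>R tensor_mat pauli_X pauli_X + \<theta>2 *\<^sub>R tensor_mat pauli_Y pauli_Y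
      + \<theta>3 *\<^sub>R tensor_mat pauli_Z pauli_Z) ** bell_proj a
   = cscale (\<i> * of_real (bell_phase \<theta>1 \<theta>2 \<theta>3 a)) (bell_proj a)"
proof -
  have sc: "r *\<^sub>R T = cscale (of_real r) T" for r and T :: gate2
    by (simp add: vec_eq_iff cscale_def scaleR_conv_of_real[where 'a=complex])
  have distr: "(A + B) ** C = A ** C + B ** C" for A B C :: gate2
    by (simp add: matrix_matrix_mult_def vec_eq_iff sum.distrib algebra_simps)
  show ?thesis
    using pauli_tensor_bell_proj[of 1 a] pauli_tensor_bell_proj[of 2 a] pauli_tensor_bell_proj[of 3 a]
    by (simp add: sc cscale_mult distr cscale_cscale cscale_add_left[symmetric] bell_phase_def ac_simps)
qed

lemma cartan_gate_bell:
  "cartan_gate \<theta>1 \<theta>2 \<theta>3 = (\<Sum>a\<in>UNIV. cscale (cis (bell_phase \<theta>1 \<theta>2 \<theta>3 a)) (bell_proj a))"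
  unfolding cartan_gate_def cis_conv_exp
  by (intro mat_exp_spectral sum_bell_proj cartan_generator_bell_proj)

text \<open>Obtained by inserting the Pauli expansion of the Bell projectors into the spectral
  decomposition of the Cartan gate.\<close>

definition cartan_coeff :: "real \<Rightarrow> real \<Rightarrow> real \<Rightarrow> nat \<Rightarrow> complex" where
  "cartan_coeff \<theta>1 \<theta>2 \<theta>3 j = (\<Sum>a\<in>UNIV. cis (bell_phase \<theta>1 \<theta>2 \<theta>3 a) * of_real (bell_sign a j) / 4)"

lemma cartan_gate_pauli_diag: "cartan_gate \<theta>1 \<theta>2 \<theta>3 = pauli_diag (cartan_coeff \<theta>1 \<theta>2 \<theta>3)"
proof -
  have "cscale (\<Sum>a\<in>K. f a) T = (\<Sum>a\<in>K. cscale (f a) T)" for K :: "4 set" and f and T :: gate2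
    by (simp add: cscale_def vec_eq_iff sum_distrib_right)
  then show ?thesis
    unfolding cartan_gate_bell bell_proj_def pauli_diag_def cscale_sum cartan_coeff_def
    by (subst sum.swap) (simp add: cscale_cscale)
qed

section \<open>Equivalence of two-qubit gates under local unitaries\<close>

definition local_equiv :: "gate2 \<Rightarrow> gate2 \<Rightarrow> bool" where
  "local_equiv U V \<longleftrightarrow> (\<exists>A B C D. unitary_mat A \<and> unitary_mat B \<and> unitary_mat C \<and> unitary_mat D \<and>
     U = tensor_mat A B ** V ** tensor_mat C D)"

lemma local_equivI:
  "unitary_mat A \<Longrightarrow> unitary_mat B \<Longrightarrow> unitary_mat C \<Longrightarrow> unitary_mat D \<Longrightarrow>
   U = tensor_mat A B ** V ** tensor_mat C D \<Longrightarrow> local_equiv U V"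
  unfolding local_equiv_def by blast

lemma local_equiv_refl: "local_equiv U U"
  by (rule local_equivI[of "mat 1" "mat 1" "mat 1" "mat 1"]) simp_all

lemma local_equiv_trans:
  assumes "local_equiv U V" "local_equiv V W"
  shows "local_equiv U W"
proof -
  obtain A B C D A' B' C' D' where
    "unitary_mat A" "unitary_mat B" "unitary_mat C" "unitary_mat D"
    "unitary_mat A'" "unitary_mat B'" "unitary_mat C'" "unitary_mat D'"
    and U: "U = tensor_mat A B ** V ** tensor_mat C D" and V: "V = tensor_mat A' B' ** W ** tensor_mat C' D'"
    using assms unfolding local_equiv_def by metis
  moreover have "U = tensor_mat (A ** A') (B ** B') ** W ** tensor_mat (C' ** C) (D' ** D)"
    by (simp add: U V tensor_mat_mult[symmetric] matrix_mul_assoc)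
  ultimately show ?thesis
    by (intro local_equivI[of "A ** A'" "B ** B'" "C' ** C" "D' ** D"]) (simp_all add: unitary_mat_mult)
qed

lemma local_equiv_sym:
  assumes "local_equiv U V"
  shows "local_equiv V U"
proof -
  obtain A B C D where un: "unitary_mat A" "unitary_mat B" "unitary_mat C" "unitary_mat D"
    and U: "U = tensor_mat A B ** V ** tensor_mat C D"
    using assms unfolding local_equiv_def by metis
  have "V = tensor_mat (adjoint_mat A) (adjoint_mat B) ** U ** tensor_mat (adjoint_mat C) (adjoint_mat D)"
    using unitary_conjugate_solve[of "tensor_mat A B" "tensor_mat C D" V "mat 1" U "mat 1"] un U
    by (simp add: unitary_tensor_mat adjoint_tensor_mat)
  then show ?thesis using un by (metis local_equivI unitary_mat_adjoint)
qed

lemma has_cartan_form_iff: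
  "has_cartan_form U \<theta>1 \<theta>2 \<theta>3 \<longleftrightarrow> \<bar>\<theta>3\<bar> \<le> \<theta>2 \<and> \<theta>2 \<le> \<theta>1 \<and> \<theta>1 \<le> pi / 4 \<and> local_equiv U (cartan_gate \<theta>1 \<theta>2 \<theta>3)"
  unfolding has_cartan_form_def local_equiv_def ..

section \<open>Reduction to the Weyl chamber\<close>

definition phase_gate :: gate where "phase_gate = vector [vector [1, 0], vector [0, \<i>]]"

definition hadamard_gate :: gate where
  "hadamard_gate = cscale (1 / sqrt 2) (vector [vector [1, 1], vector [1, -1]])"

lemma unitary_phase_gate: "unitary_mat phase_gate"
  by (rule unitary_matI) (simp add: phase_gate_def adjoint_mat_def gate2_entries)

lemma hadamard_conj_cscale:
  "hadamard_gate ** A ** hadamard_gate =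
   cscale (1 / 2) (vector [vector [1, 1], vector [1, -1]] ** A ** vector [vector [1, 1], vector [1, -1]])"
  by (simp add: hadamard_gate_def cscale_mult cscale_cscale of_real_mult[symmetric] del: of_real_mult)

lemma hadamard_conj:
  "hadamard_gate ** mat 1 ** hadamard_gate = mat 1"
  "hadamard_gate ** pauli_X ** hadamard_gate = pauli_Z"
  "hadamard_gate ** pauli_Y ** hadamard_gate = cscale (-1) pauli_Y"
  "hadamard_gate ** pauli_Z ** hadamard_gate = pauli_X"
  unfolding hadamard_conj_cscale by (simp_all add: gate2_entries)

lemma tensor_mat_neg: "tensor_mat (cscale (-1) A) (cscale (-1) B) = tensor_mat A B"
  by (simp add: tensor_mat_def cscale_def)

lemma hadamard_adjoint: "adjoint_mat hadamard_gate = hadamard_gate"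
  by (simp add: hadamard_gate_def adjoint_mat_def gate2_entries)

lemma unitary_hadamard: "unitary_mat hadamard_gate"
  by (simp add: unitary_mat_def hadamard_adjoint hadamard_conj(1)[simplified])

text \<open>Conjugation by the phase gate on both qubits exchanges X and Y up to a sign, which
  cancels in the tensor square.\<close>

lemma cartan_swap_12: "local_equiv (cartan_gate \<theta>1 \<theta>2 \<theta>3) (cartan_gate \<theta>2 \<theta>1 \<theta>3)"
proof (rule local_equivI)
  let ?S = "phase_gate" and ?S' = "adjoint_mat phase_gate"
  have conj: "?S ** ?S' = mat 1" "?S ** pauli_X ** ?S' = pauli_Y"
    "?S ** pauli_Y ** ?S' = cscale (-1) pauli_X" "?S ** pauli_Z ** ?S' = pauli_Z"
    by (simp_all add: gate2_entries adjoint_mat_def phase_gate_def)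
  have phase: "bell_phase \<theta>2 \<theta>1 \<theta>3 1 = bell_phase \<theta>1 \<theta>2 \<theta>3 4" "bell_phase \<theta>2 \<theta>1 \<theta>3 2 = bell_phase \<theta>1 \<theta>2 \<theta>3 2"
    "bell_phase \<theta>2 \<theta>1 \<theta>3 3 = bell_phase \<theta>1 \<theta>2 \<theta>3 3" "bell_phase \<theta>2 \<theta>1 \<theta>3 4 = bell_phase \<theta>1 \<theta>2 \<theta>3 1"
    by (simp_all add: bell_phase_def)
  have coeff: "cartan_coeff \<theta>2 \<theta>1 \<theta>3 0 = cartan_coeff \<theta>1 \<theta>2 \<theta>3 0"
    "cartan_coeff \<theta>2 \<theta>1 \<theta>3 (Suc 0) = cartan_coeff \<theta>1 \<theta>2 \<theta>3 2"
    "cartan_coeff \<theta>2 \<theta>1 \<theta>3 2 = cartan_coeff \<theta>1 \<theta>2 \<theta>3 (Suc 0)"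
    "cartan_coeff \<theta>2 \<theta>1 \<theta>3 3 = cartan_coeff \<theta>1 \<theta>2 \<theta>3 3"
    by (simp_all add: cartan_coeff_def sum_4 phase)
  show "cartan_gate \<theta>1 \<theta>2 \<theta>3 = tensor_mat ?S ?S ** cartan_gate \<theta>2 \<theta>1 \<theta>3 ** tensor_mat ?S' ?S'"
    unfolding cartan_gate_pauli_diag local_pauli_diag_local
    by (simp add: sum_lessThan_4 conj coeff tensor_mat_neg pauli_diag_def)
qed (simp_all add: unitary_phase_gate unitary_mat_adjoint)

text \<open>The Hadamard gate on both qubits exchanges X and Z; the sign it gives Y cancels in the
  tensor square.\<close>

lemma cartan_swap_13: "local_equiv (cartan_gate \<theta>1 \<theta>2 \<theta>3) (cartan_gate \<theta>3 \<theta>2 \<theta>1)"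
proof (rule local_equivI)
  let ?H = "hadamard_gate"
  have phase: "bell_phase \<theta>3 \<theta>2 \<theta>1 1 = bell_phase \<theta>1 \<theta>2 \<theta>3 1" "bell_phase \<theta>3 \<theta>2 \<theta>1 2 = bell_phase \<theta>1 \<theta>2 \<theta>3 4"
    "bell_phase \<theta>3 \<theta>2 \<theta>1 3 = bell_phase \<theta>1 \<theta>2 \<theta>3 3" "bell_phase \<theta>3 \<theta>2 \<theta>1 4 = bell_phase \<theta>1 \<theta>2 \<theta>3 2"
    by (simp_all add: bell_phase_def)
  have coeff: "cartan_coeff \<theta>3 \<theta>2 \<theta>1 0 = cartan_coeff \<theta>1 \<theta>2 \<theta>3 0"
    "cartan_coeff \<theta>3 \<theta>2 \<theta>1 (Suc 0) = cartan_coeff \<theta>1 \<theta>2 \<theta>3 3"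
    "cartan_coeff \<theta>3 \<theta>2 \<theta>1 2 = cartan_coeff \<theta>1 \<theta>2 \<theta>3 2"
    "cartan_coeff \<theta>3 \<theta>2 \<theta>1 3 = cartan_coeff \<theta>1 \<theta>2 \<theta>3 (Suc 0)"
    by (simp_all add: cartan_coeff_def sum_4 phase)
  show "cartan_gate \<theta>1 \<theta>2 \<theta>3 = tensor_mat ?H ?H ** cartan_gate \<theta>3 \<theta>2 \<theta>1 ** tensor_mat ?H ?H"
    unfolding cartan_gate_pauli_diag local_pauli_diag_local
    by (simp add: sum_lessThan_4 hadamard_conj hadamard_conj(1)[simplified] coeff tensor_mat_neg pauli_diag_def)
qed (simp_all add: unitary_hadamard)

text \<open>Z acts on the first qubit only, so the signs it gives X and Y survive in the tensor
  products.\<close>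

lemma cartan_flip_12: "local_equiv (cartan_gate \<theta>1 \<theta>2 \<theta>3) (cartan_gate (-\<theta>1) (-\<theta>2) \<theta>3)"
proof (rule local_equivI)
  have conj: "pauli_Z ** pauli_Z = mat 1" "pauli_Z ** pauli_X ** pauli_Z = cscale (-1) pauli_X"
    "pauli_Z ** pauli_Y ** pauli_Z = cscale (-1) pauli_Y"
    by (simp_all add: gate2_entries)
  have phase: "bell_phase (-\<theta>1) (-\<theta>2) \<theta>3 1 = bell_phase \<theta>1 \<theta>2 \<theta>3 4"
    "bell_phase (-\<theta>1) (-\<theta>2) \<theta>3 2 = bell_phase \<theta>1 \<theta>2 \<theta>3 3"
    "bell_phase (-\<theta>1) (-\<theta>2) \<theta>3 3 = bell_phase \<theta>1 \<theta>2 \<theta>3 2"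
    "bell_phase (-\<theta>1) (-\<theta>2) \<theta>3 4 = bell_phase \<theta>1 \<theta>2 \<theta>3 1"
    by (simp_all add: bell_phase_def)
  have coeff: "cartan_coeff (-\<theta>1) (-\<theta>2) \<theta>3 0 = cartan_coeff \<theta>1 \<theta>2 \<theta>3 0"
    "cartan_coeff (-\<theta>1) (-\<theta>2) \<theta>3 (Suc 0) = - cartan_coeff \<theta>1 \<theta>2 \<theta>3 (Suc 0)"
    "cartan_coeff (-\<theta>1) (-\<theta>2) \<theta>3 2 = - cartan_coeff \<theta>1 \<theta>2 \<theta>3 2"
    "cartan_coeff (-\<theta>1) (-\<theta>2) \<theta>3 3 = cartan_coeff \<theta>1 \<theta>2 \<theta>3 3"
    by (simp_all add: cartan_coeff_def sum_4 phase)
  show "cartan_gate \<theta>1 \<theta>2 \<theta>3 = tensor_mat pauli_Z (mat 1) ** cartan_gate (-\<theta>1) (-\<theta>2) \<theta>3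
      ** tensor_mat pauli_Z (mat 1)"
    unfolding cartan_gate_pauli_diag local_pauli_diag_local
    by (simp add: sum_lessThan_4 conj coeff pauli_diag_def cscale_tensor_mat[symmetric] cscale_cscale)
qed (use unitary_pauli[of 3] in simp_all)

text \<open>The extra factor exp(i (pi/2) X \<otimes> X) equals i X \<otimes> X, which is local; the
  scalar i goes into the first tensor factor.\<close>

lemma cartan_shift_1: "local_equiv (cartan_gate (\<theta>1 + pi / 2) \<theta>2 \<theta>3) (cartan_gate \<theta>1 \<theta>2 \<theta>3)"
proof (rule local_equivI)
  have XX: "tensor_mat (pauli_X ** pauli_X) (pauli_X ** pauli_X) = tensor_mat (mat 1) (mat 1)"
    "tensor_mat (pauli_X ** pauli_Y) (pauli_X ** pauli_Y) = cscale (-1) (tensor_mat pauli_Z pauli_Z)"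
    "tensor_mat (pauli_X ** pauli_Z) (pauli_X ** pauli_Z) = cscale (-1) (tensor_mat pauli_Y pauli_Y)"
    by (simp_all add: gate2_entries)
  have cis: "cis (x + pi / 2) = \<i> * cis x" "cis (x - pi / 2) = - \<i> * cis x" for x
    by (simp_all add: cis_mult[symmetric] cis_divide[symmetric])
  have phase: "bell_phase (\<theta>1 + pi / 2) \<theta>2 \<theta>3 1 = bell_phase \<theta>1 \<theta>2 \<theta>3 1 + pi / 2"
    "bell_phase (\<theta>1 + pi / 2) \<theta>2 \<theta>3 2 = bell_phase \<theta>1 \<theta>2 \<theta>3 2 + pi / 2"
    "bell_phase (\<theta>1 + pi / 2) \<theta>2 \<theta>3 3 = bell_phase \<theta>1 \<theta>2 \<theta>3 3 - pi / 2"
    "bell_phase (\<theta>1 + pi / 2) \<theta>2 \<theta>3 4 = bell_phase \<theta>1 \<theta>2 \<theta>3 4 - pi / 2"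
    by (simp_all add: bell_phase_def)
  have coeff: "cartan_coeff (\<theta>1 + pi / 2) \<theta>2 \<theta>3 0 = \<i> * cartan_coeff \<theta>1 \<theta>2 \<theta>3 (Suc 0)"
    "cartan_coeff (\<theta>1 + pi / 2) \<theta>2 \<theta>3 (Suc 0) = \<i> * cartan_coeff \<theta>1 \<theta>2 \<theta>3 0"
    "cartan_coeff (\<theta>1 + pi / 2) \<theta>2 \<theta>3 2 = - \<i> * cartan_coeff \<theta>1 \<theta>2 \<theta>3 3"
    "cartan_coeff (\<theta>1 + pi / 2) \<theta>2 \<theta>3 3 = - \<i> * cartan_coeff \<theta>1 \<theta>2 \<theta>3 2"
    unfolding cartan_coeff_def sum_4 phase cis by (simp_all add: algebra_simps)
  show "cartan_gate (\<theta>1 + pi / 2) \<theta>2 \<theta>3 = tensor_mat (cscale \<i> pauli_X) pauli_X ** cartan_gate \<theta>1 \<theta>2 \<theta>3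
      ** tensor_mat (mat 1) (mat 1)"
    unfolding cartan_gate_pauli_diag local_pauli_diag_local
    by (simp add: sum_lessThan_4 XX coeff pauli_diag_def cscale_mult cscale_tensor_mat[symmetric] cscale_cscale
        ac_simps del: tensor_mat_1)
qed (use unitary_pauli[of 1] in \<open>simp_all add: unitary_mat_cscale\<close>)

lemma cartan_shift_int: "local_equiv (cartan_gate \<theta>1 \<theta>2 \<theta>3) (cartan_gate (\<theta>1 + of_int n * (pi / 2)) \<theta>2 \<theta>3)"
proof -
  have nat: "local_equiv (cartan_gate \<theta> \<theta>2 \<theta>3) (cartan_gate (\<theta> + real k * (pi / 2)) \<theta>2 \<theta>3)" for \<theta> k
  proof (induction k)
    case (Suc k)
    have "\<theta> + real (Suc k) * (pi / 2) = \<theta> + real k * (pi / 2) + pi / 2" by (simp add: algebra_simps)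
    then show ?case using local_equiv_trans[OF Suc local_equiv_sym[OF cartan_shift_1]] by (simp only:)
  qed (simp add: local_equiv_refl)
  show ?thesis
  proof (cases "n \<ge> 0")
    case True
    then show ?thesis using nat[of \<theta>1 "Int.nat n"] by simp
  next
    case False
    then show ?thesis
      using local_equiv_sym[OF nat[of "\<theta>1 + of_int n * (pi / 2)" "Int.nat (- n)"]] by (simp add: algebra_simps)
  qed
qed

lemma round_to_quarter_pi: "\<exists>n::int. \<bar>\<theta> + of_int n * (pi / 2)\<bar> \<le> pi / 4"
proof -
  have "\<bar>of_int (round (\<theta> / (pi / 2))) - \<theta> / (pi / 2)\<bar> * (pi / 2) \<le> 1 / 2 * (pi / 2)"
    by (intro mult_right_mono of_int_round_abs_le) simp
  moreover have "\<bar>of_int (round (\<theta> / (pi / 2))) - \<theta> / (pi / 2)\<bar> * (pi / 2) =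
      \<bar>(of_int (round (\<theta> / (pi / 2))) - \<theta> / (pi / 2)) * (pi / 2)\<bar>"
    by (simp add: abs_mult)
  moreover have "(of_int (round (\<theta> / (pi / 2))) - \<theta> / (pi / 2)) * (pi / 2)
      = - (\<theta> + of_int (- round (\<theta> / (pi / 2))) * (pi / 2))"
    by (simp add: field_simps)
  ultimately have "\<bar>\<theta> + of_int (- round (\<theta> / (pi / 2))) * (pi / 2)\<bar> \<le> pi / 4"
    by (simp only: abs_minus)
  then show ?thesis by blast
qed

text \<open>Each angle is first reduced modulo \<open>pi / 2\<close> to modulus at most
  \<open>pi / 4\<close>, then the angles are sorted by modulus, and finally signs are
  adjusted.\<close>

lemma cartan_gate_chamber:
  "\<exists>a b c. \<bar>c\<bar> \<le> b \<and> b \<le> a \<and> a \<le> pi / 4 \<and> local_equiv (cartan_gate \<theta>1 \<theta>2 \<theta>3) (cartan_gate a b c)"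
proof -
  define P where "P a b c \<longleftrightarrow> local_equiv (cartan_gate \<theta>1 \<theta>2 \<theta>3) (cartan_gate a b c)" for a b c
  have s12: "P b a c" and s13: "P c b a" and f12: "P (-a) (-b) c" and sh: "P (a + of_int n * (pi / 2)) b c"
    if "P a b c" for a b c and n :: int
    using that local_equiv_trans cartan_swap_12 cartan_swap_13 cartan_flip_12 cartan_shift_int
    unfolding P_def by blast+
  have s23: "P a c b" if "P a b c" for a b c using s12[OF s13[OF s12[OF that]]] .
  obtain n1 n2 n3 where n: "\<bar>\<theta>1 + of_int n1 * (pi / 2)\<bar> \<le> pi / 4" "\<bar>\<theta>2 + of_int n2 * (pi / 2)\<bar> \<le> pi / 4"
      "\<bar>\<theta>3 + of_int n3 * (pi / 2)\<bar> \<le> pi / 4"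
    using round_to_quarter_pi by metis
  have "P (\<theta>1 + of_int n1 * (pi / 2)) (\<theta>2 + of_int n2 * (pi / 2)) (\<theta>3 + of_int n3 * (pi / 2))"
    \<comment> \<open>Shifts act on the first angle only; the swaps carry the second and third
      angles there and back.\<close>
    using s13[OF sh[OF s13[OF s12[OF sh[OF s12[OF sh]]]]]] local_equiv_refl unfolding P_def by blast
  then obtain a b c where abc: "P a b c" "\<bar>a\<bar> \<le> pi / 4" "\<bar>b\<bar> \<le> pi / 4" "\<bar>c\<bar> \<le> pi / 4" using n by blast
  have "\<exists>a b c. P a b c \<and> \<bar>a\<bar> \<le> pi / 4 \<and> \<bar>b\<bar> \<le> \<bar>a\<bar> \<and> \<bar>c\<bar> \<le> \<bar>a\<bar>"
  proof -
    consider "\<bar>b\<bar> \<le> \<bar>a\<bar>" "\<bar>c\<bar> \<le> \<bar>a\<bar>" | "\<bar>a\<bar> \<le> \<bar>b\<bar>" "\<bar>c\<bar> \<le> \<bar>b\<bar>"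
      | "\<bar>a\<bar> \<le> \<bar>c\<bar>" "\<bar>b\<bar> \<le> \<bar>c\<bar>" by linarith
    then show ?thesis using abc s12[OF abc(1)] s13[OF abc(1)] by cases blast+
  qed
  then obtain a b c where abc: "P a b c" "\<bar>a\<bar> \<le> pi / 4" "\<bar>b\<bar> \<le> \<bar>a\<bar>" "\<bar>c\<bar> \<le> \<bar>a\<bar>" by blast
  have "\<exists>b c. P a b c \<and> \<bar>b\<bar> \<le> \<bar>a\<bar> \<and> \<bar>c\<bar> \<le> \<bar>b\<bar>"
    using abc s23[OF abc(1)] linear[of "\<bar>b\<bar>" "\<bar>c\<bar>"] by blast
  then obtain b c where abc: "P a b c" "\<bar>a\<bar> \<le> pi / 4" "\<bar>b\<bar> \<le> \<bar>a\<bar>" "\<bar>c\<bar> \<le> \<bar>b\<bar>"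
    using abc(2) by blast
  \<comment> \<open>Signs flip only in pairs, so making the first two angles nonnegative may change
    the sign of the third.\<close>
  have "P \<bar>a\<bar> \<bar>b\<bar> c \<or> P \<bar>a\<bar> \<bar>b\<bar> (-c)"
  proof -
    have "P (-a) (-b) c" "P (-a) b (-c)" "P a (-b) (-c)"
      using f12[OF abc(1)] s23[OF f12[OF s23[OF abc(1)]]] s13[OF f12[OF s13[OF abc(1)]]] s13 by auto
    then show ?thesis using abc(1) by (auto simp: abs_if)
  qed
  then show ?thesis using abc unfolding P_def by (metis abs_ge_zero abs_minus_cancel)
qed

section \<open>Existence of the Cartan form\<close>

definition cvec :: "real^'n \<Rightarrow> complex^'n" where
  "cvec x = (\<chi> i. of_real (x $ i))"

lemma unitary_mat_transpose:
  assumes "unitary_mat U"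
  shows "unitary_mat (transpose U)"
proof -
  have "adjoint_mat (transpose U) = transpose (adjoint_mat U)"
    by (simp add: adjoint_mat_def transpose_def)
  then show ?thesis using assms by (simp add: unitary_mat_def matrix_transpose_mul[symmetric] transpose_mat)
qed

text \<open>Takagi-type factorisation: \<open>W\<^sup>T W\<close> is a symmetric unitary, so its real and imaginary parts
  commute and have a common real eigenbasis \<open>v\<close>. Dividing \<open>W v\<close> by a square root of the eigenvalue
  gives vectors that are orthonormal for both the bilinear and the sesquilinear form, hence real.\<close>

lemma unitary_real_frames:
  fixes W :: "complex^'n^'n"
  assumes W: "unitary_mat W"
  shows "\<exists>v w :: 'n \<Rightarrow> real^'n. \<exists>d. (\<forall>a b. v a \<bullet> v b = (if a = b then 1 else 0)) \<and>
    (\<forall>a b. w a \<bullet> w b = (if a = b then 1 else 0)) \<and>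
    (\<forall>a. cmod (d a) = 1 \<and> W *v cvec (v a) = d a *s cvec (w a))"
proof -
  define m where "m = transpose W ** W"
  define R where "R = (\<chi> i j. Re (m$i$j))"
  define S where "S = (\<chi> i j. Im (m$i$j))"
  have unm: "unitary_mat m" using W by (simp add: m_def unitary_mat_mult unitary_mat_transpose)
  have sym: "m$j$i = m$i$j" for i j
    by (simp add: m_def matrix_matrix_mult_def transpose_def mult.commute)
  have RT: "transpose R = R" and ST: "transpose S = S"
    by (simp_all add: R_def S_def transpose_def vec_eq_iff sym)
  \<comment> \<open>By symmetry the adjoint of \<open>m\<close> is R - i S, and the imaginary part
    of (R - i S)(R + i S) is the commutator of \<open>R\<close> and \<open>S\<close>. Unitarity
    makes it vanish.\<close>
  have "(R ** S)$i$j - (S ** R)$i$j = Im ((adjoint_mat m ** m)$i$j)" for i j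
    by (simp add: adjoint_mat_def matrix_matrix_mult_def R_def S_def sym sum_subtractf)
  moreover have "Im ((adjoint_mat m ** m)$i$j) = 0" for i j
    using unm by (simp add: unitary_mat_def mat_def)
  ultimately have RS: "R ** S = S ** R" by (simp add: vec_eq_iff)
  have sa: "(A *v x) \<bullet> y = x \<bullet> (A *v y)" if "transpose A = A" for A :: "real^'n^'n" and x y
    by (metis dot_lmul_matrix that vector_transpose_matrix)
  have "\<exists>B. finite B \<and> card B = DIM(real^'n) \<and> (\<forall>x\<in>B. \<forall>y\<in>B. x \<bullet> y = (if x = y then 1 else 0)) \<and>
    (\<forall>v\<in>B. (\<exists>l. R *v v = l *\<^sub>R v) \<and> (\<exists>m. S *v v = m *\<^sub>R v))"
    by (intro commuting_selfadjoint_orthonormal sa RT ST matrix_vector_mul_linear)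
      (simp_all add: matrix_vector_mul_assoc RS)
  then obtain B :: "(real^'n) set" where B: "finite B" "card B = CARD('n)"
      "\<And>x y. x \<in> B \<Longrightarrow> y \<in> B \<Longrightarrow> x \<bullet> y = (if x = y then 1 else 0)"
      "\<And>v. v \<in> B \<Longrightarrow> \<exists>l m. R *v v = l *\<^sub>R v \<and> S *v v = m *\<^sub>R v" by auto
  obtain v :: "'n \<Rightarrow> real^'n" where v: "bij_betw v UNIV B"
    using finite_same_card_bij[of "UNIV :: 'n set" B] B(1,2) by auto
  have vB: "v a \<in> B" for a using v by (auto simp: bij_betw_def)
  have von: "v a \<bullet> v b = (if a = b then 1 else 0)" for a b
    using B(3)[OF vB vB] v by (simp add: bij_betw_def inj_eq)
  have mc: "m *v cvec x = cvec (R *v x) + \<i> *s cvec (S *v x)" for x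
    by (simp add: vec_eq_iff complex_eq_iff matrix_vector_mult_def cvec_def R_def S_def)
  have "\<exists>z. m *v cvec (v a) = z *s cvec (v a)" for a
  proof -
    obtain l k where "R *v v a = l *\<^sub>R v a" "S *v v a = k *\<^sub>R v a" using B(4)[OF vB] by blast
    then have "m *v cvec (v a) = Complex l k *s cvec (v a)"
      unfolding mc by (simp add: vec_eq_iff cvec_def complex_eq_iff)
    then show ?thesis ..
  qed
  then obtain z where z: "\<And>a. m *v cvec (v a) = z a *s cvec (v a)" by metis
  define t where "t x y = (\<Sum>i\<in>UNIV. x$i * y$i)" for x y :: "complex^'n"
  define h where "h x y = (\<Sum>i\<in>UNIV. cnj (x$i) * y$i)" for x y :: "complex^'n"
  have tc: "t (cvec x) (cvec y) = of_real (x \<bullet> y)" "h (cvec x) (cvec y) = of_real (x \<bullet> y)" for x y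
    by (simp_all add: t_def h_def cvec_def inner_vec_def)
  have ts: "t (c *s x) y = c * t x y" "t x (c *s y) = c * t x y"
      "h (c *s x) y = cnj c * h x y" "h x (c *s y) = c * h x y" for c x y
    by (simp_all add: t_def h_def sum_distrib_left ac_simps)
  have tW: "t (W *v x) (W *v y) = t x (m *v y)" and hW: "h (W *v x) (W *v y) = h x ((adjoint_mat W ** W) *v y)" for x y
  proof -
    have sw: "(\<Sum>i\<in>UNIV. (\<Sum>j\<in>UNIV. A i j * x j) * (\<Sum>k\<in>UNIV. D i k * y$k)) =
       (\<Sum>j\<in>UNIV. x j * (\<Sum>k\<in>UNIV. (\<Sum>i\<in>UNIV. A i j * D i k) * y$k))"
      for A D :: "'n \<Rightarrow> 'n \<Rightarrow> complex" and x :: "'n \<Rightarrow> complex"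
    proof -
      have "(\<Sum>i\<in>UNIV. (\<Sum>j\<in>UNIV. A i j * x j) * (\<Sum>k\<in>UNIV. D i k * y$k)) =
          (\<Sum>i\<in>UNIV. \<Sum>j\<in>UNIV. \<Sum>k\<in>UNIV. A i j * x j * (D i k * y$k))" by (simp add: sum_product)
      also have "\<dots> = (\<Sum>j\<in>UNIV. \<Sum>k\<in>UNIV. \<Sum>i\<in>UNIV. A i j * x j * (D i k * y$k))"
        by (subst sum.swap) (intro sum.cong refl sum.swap)
      finally show ?thesis by (simp add: sum_distrib_left sum_distrib_right ac_simps)
    qed
    show "t (W *v x) (W *v y) = t x (m *v y)"
      using sw[of "\<lambda>i j. W$i$j" "\<lambda>j. x$j" "\<lambda>i j. W$i$j"]
      by (simp add: t_def m_def matrix_vector_mult_def matrix_matrix_mult_def transpose_def)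
    show "h (W *v x) (W *v y) = h x ((adjoint_mat W ** W) *v y)"
      using sw[of "\<lambda>i j. cnj (W$i$j)" "\<lambda>j. cnj (x$j)" "\<lambda>i j. W$i$j"]
      by (simp add: h_def adjoint_mat_def matrix_vector_mult_def matrix_matrix_mult_def)
  qed
  have z1: "cmod (z a) = 1" for a
  proof -
    have hm: "h (m *v x) (m *v x) = h x x" for x
      by (simp add: h_def sum_cnj_mult_self norm_unitary_mat[OF unm])
    have "cnj (z a) * z a = 1"
      using hm[of "cvec (v a)"] by (simp add: z ts tc von mult.commute)
    then have "complex_of_real ((cmod (z a))\<^sup>2) = 1" by (simp add: complex_norm_square mult.commute del: of_real_power)
    then have "(cmod (z a))\<^sup>2 = 1" by (metis of_real_eq_1_iff)
    then show ?thesis by (simp add: power2_eq_1_iff) (metis norm_ge_zero not_one_le_zero le_minus_one_simps(3))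
  qed
  define d where "d a = csqrt (z a)" for a
  have dd: "d a * d a = z a" for a using power2_csqrt[of "z a"] by (simp add: d_def power2_eq_square)
  have d1: "cmod (d a) = 1" for a using z1 by (simp add: d_def norm_csqrt)
  then have d0: "d a \<noteq> 0" for a by (metis norm_zero zero_neq_one)
  have dc: "cnj (d a) * d a = 1" for a using d1[of a] by (simp add: mult.commute complex_norm_square[symmetric])
  \<comment> \<open>Dividing by a square root of the eigenvalue makes \<open>t (y a) (y a)\<close>
    equal to 1; as \<open>d a\<close> has modulus 1, \<open>h (y a) (y a)\<close> stays 1.\<close>
  define y where "y a = inverse (d a) *s (W *v cvec (v a))" for a
  have ty: "t (y a) (y b) = (if a = b then 1 else 0)" for a b
    by (simp add: y_def ts tW z tc von) (simp add: dd[symmetric] d0 field_simps)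
  have hy: "h (y a) (y a) = 1" for a
    using W dc[of a] by (simp add: y_def ts hW unitary_mat_def tc von field_simps d0)
  define w where "w a = (\<chi> i. Re (y a $ i))" for a
  have yw: "y a = cvec (w a)" for a
  proof -
    \<comment> \<open>For a complex number, squared modulus minus real part of the square is twice
      the squared imaginary part.\<close>
    have "(\<Sum>i\<in>UNIV. (Im (y a $ i))\<^sup>2) = (Re (h (y a) (y a)) - Re (t (y a) (y a))) / 2"
      by (simp add: h_def t_def sum_subtractf[symmetric] sum_divide_distrib power2_eq_square)
    then have "(\<Sum>i\<in>UNIV. (Im (y a $ i))\<^sup>2) = 0" by (simp add: ty hy)
    then have "Im (y a $ i) = 0" for i by (simp add: sum_nonneg_eq_0_iff)
    then show ?thesis by (simp add: w_def cvec_def vec_eq_iff complex_eq_iff)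
  qed
  have "w a \<bullet> w b = (if a = b then 1 else 0)" for a b
    using ty[of a b] by (simp add: yw tc split: if_splits)
  moreover have "W *v cvec (v a) = d a *s cvec (w a)" for a
    by (simp add: yw[symmetric] y_def d0)
  ultimately show ?thesis using von d1 by blast
qed

text \<open>The unit quaternions \<open>1, i, j, k\<close> are sent to \<open>1, i X, - i Y, i Z\<close>.\<close>

definition quat_gate :: "real^4 \<Rightarrow> gate" where
  "quat_gate x = vector [vector [Complex (x$1) (x$4), Complex (- x$3) (x$2)],
                         vector [Complex (x$3) (x$2), Complex (x$1) (- x$4)]]"

lemma quat_gate_mult: "quat_gate (x \<odot> y) = quat_gate x ** quat_gate y"
  by (simp add: quat_gate_def gate2_entries complex_eq_iff algebra_simps)

lemma quat_gate_scaleR: "quat_gate (c *\<^sub>R x) = cscale (of_real c) (quat_gate x)"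
  by (simp add: quat_gate_def gate2_entries complex_eq_iff)

lemma unitary_quat_gate: "x \<bullet> x = 1 \<Longrightarrow> unitary_mat (quat_gate x)"
  by (rule unitary_matI) (simp add: quat_gate_def adjoint_mat_def gate2_entries complex_eq_iff inner_vec4 algebra_simps)

text \<open>Row-by-row reshaping of a matrix into amplitudes. Local gates then act by multiplication
  on both sides, matching the shape \<open>p \<odot> axis a 1 \<odot> r\<close> of a frame
  vector.\<close>

definition vec_gate :: "gate \<Rightarrow> qubit2" where
  "vec_gate M = (\<chi> i. M $ fst i $ snd i)"

lemma tensor_mat_vec_gate: "tensor_mat A B *v vec_gate M = vec_gate (A ** M ** transpose B)"
  by (simp add: tensor_mat_def vec_gate_def matrix_vector_mult_def matrix_matrix_mult_def transpose_def
      vec_eq_iff sum_prod_UNIV sum_2 algebra_simps)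

lemma vec_gate_cscale: "vec_gate (cscale c M) = c *s vec_gate M"
  by (simp add: vec_gate_def cscale_def vec_eq_iff)

text \<open>The magic basis, in which local gates of determinant 1 become real.\<close>

definition magic :: "complex^4^(2 \<times> 2)" where
  "magic = (\<chi> i a. vec_gate (quat_gate (axis a 1)) $ i / sqrt 2)"

lemma magic_unitary: "adjoint_mat magic ** magic = mat 1" "magic ** adjoint_mat magic = mat 1"
proof -
  show "adjoint_mat magic ** magic = mat 1"
    by (simp add: magic_def adjoint_mat_def vec_eq_iff forall_4 matrix_matrix_mult_def sum_prod_UNIV sum_2 mat_def
        vec_gate_def quat_gate_def axis_def complex_eq_iff)
  show "magic ** adjoint_mat magic = mat 1"
    by (simp add: magic_def adjoint_mat_def vec_eq_iff split_paired_All forall_2 matrix_matrix_mult_def sum_4 mat_def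
        vec_gate_def quat_gate_def axis_def complex_eq_iff)
qed

lemma magic_cvec: "magic *v cvec x = (1 / sqrt 2) *s vec_gate (quat_gate x)"
  by (simp add: magic_def cvec_def matrix_vector_mult_def vec_eq_iff split_paired_All forall_2 sum_4
        vec_gate_def quat_gate_def axis_def complex_eq_iff)

text \<open>The reshaped matrices 1, i X, - i Y, i Z are, up to scalars, the four Bell states in the
  order used by \<open>bell_sign\<close>.\<close>

lemma bell_proj_vec_gate:
  "bell_proj b *v vec_gate (quat_gate (axis a 1)) = (if a = b then 1 else 0) *s vec_gate (quat_gate (axis a 1))"
proof -
  have "\<forall>a b. bell_proj b *v vec_gate (quat_gate (axis a 1)) = (if a = b then 1 else 0) *s vec_gate (quat_gate (axis a 1))"
    unfolding forall_4 bell_proj_def pauli_diag_def sum_lessThan_4 pauli_nth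
    by (simp add: gate2_entries matrix_vector_mult_def vec_gate_def quat_gate_def axis_def complex_eq_iff)
  then show ?thesis by blast
qed

lemma cartan_gate_vec_gate:
  "cartan_gate \<theta>1 \<theta>2 \<theta>3 *v vec_gate (quat_gate (axis a 1))
    = cis (bell_phase \<theta>1 \<theta>2 \<theta>3 a) *s vec_gate (quat_gate (axis a 1))"
proof -
  have "cartan_gate \<theta>1 \<theta>2 \<theta>3 *v vec_gate (quat_gate (axis a 1)) = (\<Sum>b\<in>UNIV. if a = b
      then cis (bell_phase \<theta>1 \<theta>2 \<theta>3 b) *s vec_gate (quat_gate (axis a 1)) else 0)"
    unfolding cartan_gate_bell matrix_vector_mult_sum cscale_matrix_vector_mult bell_proj_vec_gate
    by (intro sum.cong) auto
  then show ?thesis by simp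
qed

text \<open>These vectors are, up to the factor \<open>sqrt 2\<close>, the columns of the invertible
  matrix \<open>magic\<close>.\<close>

lemma gate2_eqI:
  fixes G H :: gate2
  assumes "\<And>a. G *v vec_gate (quat_gate (axis a 1)) = H *v vec_gate (quat_gate (axis a 1))"
  shows "G = H"
proof -
  have col: "(K ** magic) $ i $ a = (K *v vec_gate (quat_gate (axis a 1))) $ i / sqrt 2" for K :: gate2 and i a
    by (simp add: magic_def matrix_matrix_mult_def matrix_vector_mult_def sum_divide_distrib)
  have "G ** magic = H ** magic" using assms by (simp add: vec_eq_iff col)
  then have "G ** magic ** adjoint_mat magic = H ** magic ** adjoint_mat magic" by simp
  then show ?thesis by (simp add: matrix_mul_assoc[symmetric] magic_unitary)
qed

text \<open>The three sign patterns and the constant one are orthogonal, hence a basis of the phase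
  vectors; the mean \<open>c\<close> becomes a global phase.\<close>

lemma cartan_phases:
  "\<exists>c \<theta>1 \<theta>2 \<theta>3. \<forall>a. \<phi> a = c + bell_phase \<theta>1 \<theta>2 \<theta>3 a"
proof -
  define c where "c = (\<phi> 1 + \<phi> 2 + \<phi> 3 + \<phi> 4) / 4"
  have "\<forall>a. \<phi> a = c + bell_phase ((\<phi> 1 + \<phi> 2) / 2 - c) ((\<phi> 2 + \<phi> 4) / 2 - c) ((\<phi> 1 + \<phi> 4) / 2 - c) a"
    unfolding forall_4 by (simp add: bell_phase_def c_def field_simps)
  then show ?thesis by blast
qed

text \<open>In the magic basis \<open>U\<close> maps a real frame to another up to phases. Each
  frame is the image of the Bell vectors under a local gate, \<open>L\<close> or \<open>L'\<close>,
  up to a sign, so \<open>U\<close> becomes diagonal on the Bell vectors between these gates, as a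
  Cartan gate is.\<close>

lemma unitary_local_equiv_cartan:
  assumes U: "unitary_mat U"
  shows "\<exists>\<theta>1 \<theta>2 \<theta>3. local_equiv U (cartan_gate \<theta>1 \<theta>2 \<theta>3)"
proof -
  define W where "W = adjoint_mat magic ** U ** magic"
  \<comment> \<open>\<open>magic\<close> has different row and column index types, so
    \<open>unitary_mat\<close> does not apply to it and the product is expanded by hand.\<close>
  have "adjoint_mat W ** W = adjoint_mat magic ** adjoint_mat U ** (magic ** adjoint_mat magic) ** U ** magic"
    by (simp add: W_def adjoint_mat_mult matrix_mul_assoc)
  also have "\<dots> = adjoint_mat magic ** (adjoint_mat U ** U) ** magic"
    by (simp add: magic_unitary matrix_mul_assoc)
  also have "\<dots> = mat 1" using U by (simp add: unitary_mat_def magic_unitary)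
  finally have "unitary_mat W" by (rule unitary_matI)
  from unitary_real_frames[OF this] obtain v w :: "4 \<Rightarrow> real^4" and d where
    frames: "\<forall>a b. v a \<bullet> v b = (if a = b then 1 else 0)" "\<forall>a b. w a \<bullet> w b = (if a = b then 1 else 0)"
      "\<forall>a. cmod (d a) = 1 \<and> W *v cvec (v a) = d a *s cvec (w a)" by blast
  then have d: "cmod (d a) = 1" "W *v cvec (v a) = d a *s cvec (w a)" for a by auto
  obtain p r s where p: "p \<bullet> p = 1" and r: "r \<bullet> r = 1" and s: "s = 1 \<or> s = -1"
    and veq: "\<And>a. v a = (if a = 4 then s else 1) *\<^sub>R (p \<odot> axis a 1 \<odot> r)"
    using orthonormal_frame_quaternion[of v] frames(1) by blast
  obtain p' r' s' where p': "p' \<bullet> p' = 1" and r': "r' \<bullet> r' = 1" and s': "s' = 1 \<or> s' = -1"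
    and weq: "\<And>a. w a = (if a = 4 then s' else 1) *\<^sub>R (p' \<odot> axis a 1 \<odot> r')"
    using orthonormal_frame_quaternion[of w] frames(2) by blast
  \<comment> \<open>The second factor is transposed because \<open>tensor_mat_vec_gate\<close>
    multiplies on the right by a transpose.\<close>
  define L where "L = tensor_mat (quat_gate p) (transpose (quat_gate r))"
  define L' where "L' = tensor_mat (quat_gate p') (transpose (quat_gate r'))"
  define q where "q a = vec_gate (quat_gate (axis a 1))" for a
  have unL: "unitary_mat L" "unitary_mat L'"
    using p r p' r' by (simp_all add: L_def L'_def unitary_tensor_mat unitary_quat_gate unitary_mat_transpose)
  have UQ: "U *v (magic *v x) = magic *v (W *v x)" for x
    by (simp add: W_def matrix_vector_mul_assoc matrix_mul_assoc magic_unitary)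
  have Uv: "U *v vec_gate (quat_gate (v a)) = d a *s vec_gate (quat_gate (w a))" for a
  proof -
    have lin: "A *v (c *s x) = c *s (A *v x)" for A :: "complex^'m::finite^'k" and c x
      by (simp add: matrix_vector_mult_def vec_eq_iff sum_distrib_left ac_simps)
    have "(1 / sqrt 2) *s (U *v vec_gate (quat_gate (v a))) = (1 / sqrt 2) *s (d a *s vec_gate (quat_gate (w a)))"
      using UQ[of "cvec (v a)"] by (simp add: d magic_cvec lin vec_eq_iff ac_simps)
    then show ?thesis by (simp add: vec_eq_iff)
  qed
  \<comment> \<open>The orientation signs of the two frames are absorbed into the phase of the
    fourth vector.\<close>
  define e where "e a = d a * (if a = 4 then of_real (s * s') else 1)" for a
  have e1: "cmod (e a) = 1" for a using d(1) s s' by (auto simp: e_def norm_mult)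
  have UL: "U *v (L *v q a) = e a *s (L' *v q a)" for a
  proof -
    define \<sigma> where "\<sigma> = (if a = 4 then s else 1)"
    define \<tau> where "\<tau> = (if a = 4 then s' else 1)"
    have \<sigma>: "\<sigma> * \<sigma> = 1" using s by (auto simp: \<sigma>_def)
    have Lq: "vec_gate (quat_gate (v a)) = of_real \<sigma> *s (L *v q a)"
        "vec_gate (quat_gate (w a)) = of_real \<tau> *s (L' *v q a)"
      by (simp_all add: veq weq \<sigma>_def \<tau>_def L_def L'_def q_def tensor_mat_vec_gate quat_gate_scaleR
          quat_gate_mult vec_gate_cscale)
    have "of_real \<sigma> *s (of_real \<sigma> *s (U *v (L *v q a))) = of_real \<sigma> *s (d a *s (of_real \<tau> *s (L' *v q a)))"
      using Uv[of a] by (simp only: Lq vector_scalar_commute)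
    then have "of_real (\<sigma> * \<sigma>) *s (U *v (L *v q a)) = (d a * of_real (\<sigma> * \<tau>)) *s (L' *v q a)"
      by (simp add: vector_smult_assoc ac_simps)
    moreover have "d a * of_real (\<sigma> * \<tau>) = e a" by (simp add: e_def \<sigma>_def \<tau>_def)
    ultimately show ?thesis by (simp add: \<sigma>)
  qed
  obtain c \<theta>1 \<theta>2 \<theta>3 where ph: "\<And>a. Arg (e a) = c + bell_phase \<theta>1 \<theta>2 \<theta>3 a"
    using cartan_phases[of "\<lambda>a. Arg (e a)"] by blast
  have ecis: "e a = cis c * cis (bell_phase \<theta>1 \<theta>2 \<theta>3 a)" for a
    using cis_Arg[of "e a"] e1[of a] by (simp add: cis_mult ph[symmetric] sgn_eq) (metis norm_zero zero_neq_one)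
  have "adjoint_mat L' ** U ** L = cscale (cis c) (cartan_gate \<theta>1 \<theta>2 \<theta>3)"
  proof (rule gate2_eqI, fold q_def)
    fix a
    have "(adjoint_mat L' ** U ** L) *v q a = adjoint_mat L' *v (e a *s (L' *v q a))"
      by (simp add: matrix_vector_mul_assoc[symmetric] UL)
    also have "\<dots> = e a *s ((adjoint_mat L' ** L') *v q a)"
      by (simp add: matrix_vector_mul_assoc[symmetric] vector_scalar_commute)
    also have "\<dots> = e a *s q a" using unL(2) by (simp add: unitary_mat_def)
    also have "\<dots> = cscale (cis c) (cartan_gate \<theta>1 \<theta>2 \<theta>3) *v q a"
      by (simp add: ecis q_def cscale_matrix_vector_mult cartan_gate_vec_gate vector_smult_assoc)
    finally show "(adjoint_mat L' ** U ** L) *v q a = cscale (cis c) (cartan_gate \<theta>1 \<theta>2 \<theta>3) *v q a" .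
  qed
  then have "U = cscale (cis c) (L' ** cartan_gate \<theta>1 \<theta>2 \<theta>3 ** adjoint_mat L)"
    using unitary_conjugate_solve[of "adjoint_mat L'" L U "mat 1" "cscale (cis c) (cartan_gate \<theta>1 \<theta>2 \<theta>3)" "mat 1"] unL
    by (simp add: unitary_mat_adjoint cscale_mult)
  \<comment> \<open>The global phase moves into one single-qubit factor.\<close>
  also have "\<dots> = tensor_mat (cscale (cis c) (quat_gate p')) (transpose (quat_gate r')) ** cartan_gate \<theta>1 \<theta>2 \<theta>3
      ** tensor_mat (adjoint_mat (quat_gate p)) (adjoint_mat (transpose (quat_gate r)))"
    by (simp add: L_def L'_def adjoint_tensor_mat cscale_tensor_mat[symmetric] cscale_mult)
  finally have "local_equiv U (cartan_gate \<theta>1 \<theta>2 \<theta>3)"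
    using p r p' r'
    by (intro local_equivI) (auto simp: unitary_mat_cscale unitary_quat_gate unitary_mat_transpose unitary_mat_adjoint)
  then show ?thesis by blast
qed

section \<open>CNOT and the minimum\<close>

lemma cartan_coeff_cnot:
  "cartan_coeff (pi / 4) 0 0 0 = 1 / sqrt 2" "cartan_coeff (pi / 4) 0 0 (Suc 0) = \<i> / sqrt 2"
  "cartan_coeff (pi / 4) 0 0 2 = 0" "cartan_coeff (pi / 4) 0 0 3 = 0"
proof -
  have c: "cis (pi / 4) = (1 + \<i>) / sqrt 2" "cis (- (pi / 4)) = (1 - \<i>) / sqrt 2"
    by (simp_all add: complex_eq_iff cos_45 sin_45 real_div_sqrt field_simps)
  show "cartan_coeff (pi / 4) 0 0 0 = 1 / sqrt 2" "cartan_coeff (pi / 4) 0 0 (Suc 0) = \<i> / sqrt 2"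
    "cartan_coeff (pi / 4) 0 0 2 = 0" "cartan_coeff (pi / 4) 0 0 3 = 0"
    by (simp_all add: cartan_coeff_def sum_4 bell_phase_def c) (simp_all add: field_simps)
qed

text \<open>The Hadamard gates on the control turn exp(i (pi/4) X \<otimes> X) into exp(i (pi/4) Z
  \<otimes> X). With \<open>?B\<close> = exp(- i (pi/4) X) on the target this is the identity for
  control 0 and - i X for control 1, where the phase gate supplies the missing i.\<close>

lemma CNOT_local_equiv: "local_equiv CNOT (cartan_gate (pi / 4) 0 0)"
proof (rule local_equivI)
  let ?B = "cscale (1 / sqrt 2) (mat 1 + cscale (- \<i>) pauli_X)"
  have half: "1 / complex_of_real (sqrt 2) * (1 / complex_of_real (sqrt 2)) = 1 / 2"
    by (simp add: of_real_mult[symmetric] del: of_real_mult)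
  have conj: "phase_gate ** hadamard_gate ** M ** hadamard_gate = phase_gate ** (hadamard_gate ** M ** hadamard_gate)" for M
    by (simp add: matrix_mul_assoc)
  have zero: "cscale 0 M = 0" for M :: gate2
    by (simp add: cscale_def vec_eq_iff)
  have sw: "tensor_mat A (cscale c B) = cscale c (tensor_mat A B)" for A B c
    by (simp add: tensor_mat_def cscale_def vec_eq_iff)
  have "tensor_mat (phase_gate ** hadamard_gate) ?B ** cartan_gate (pi / 4) 0 0 ** tensor_mat hadamard_gate (mat 1)
      = cscale (1 / 2) (tensor_mat phase_gate (mat 1 + cscale (- \<i>) pauli_X))
      + cscale (\<i> / 2) (tensor_mat (phase_gate ** pauli_Z) ((mat 1 + cscale (- \<i>) pauli_X) ** pauli_X))"
    unfolding cartan_gate_pauli_diag local_pauli_diag_local sum_lessThan_4 cartan_coeff_cnot pauli_nth conj hadamard_conj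
    using half by (simp add: cscale_mult sw cscale_cscale zero)
  also have "\<dots> = CNOT"
    by (simp add: CNOT_def gate2_entries phase_gate_def)
  finally show "CNOT = tensor_mat (phase_gate ** hadamard_gate) ?B ** cartan_gate (pi / 4) 0 0
      ** tensor_mat hadamard_gate (mat 1)" ..
  show "unitary_mat ?B"
    by (rule unitary_matI) (simp add: adjoint_mat_def gate2_entries complex_eq_iff)
qed (simp_all add: unitary_phase_gate unitary_hadamard unitary_mat_mult)

lemma qp_extent_CNOT: "qp_extent CNOT = 3"
proof -
  have "has_cartan_form CNOT (pi / 4) 0 0"
    using CNOT_local_equiv by (simp add: has_cartan_form_iff)
  from qp_extent_eq[OF this cartan_gate_pauli_diag] show ?thesis
    by (simp add: sum_lessThan_4 cartan_coeff_cnot norm_divide power_divide)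
qed

lemma perfect_entangler_CNOT: "perfect_entangler CNOT"
  unfolding perfect_entangler_def
proof (intro conjI exI)
  \<comment> \<open>The control is in an equal superposition and the target in ket 0; CNOT then
    produces the Bell state 00 + 11.\<close>
  let ?a = "vector [1 / sqrt 2, 1 / sqrt 2] :: qubit" and ?b = "axis 1 1 :: qubit"
  show "unitary_mat CNOT"
    by (rule unitary_matI) (simp add: CNOT_def adjoint_mat_def gate2_entries, simp add: mat_def)
  show "norm ?a = 1" by (simp add: norm_vec_def L2_set_def sum_2 norm_divide power_divide)
  show "norm ?b = 1" by (simp add: norm_axis_1)
  have on: "orthonormal_pair (axis 1 1) (axis 2 1)"
    by (simp add: orthonormal_pair_def norm_axis_1) (simp add: sum_2 axis_def)
  have "CNOT *v tensor_vec ?a ?b = (1 / sqrt 2) *\<^sub>R tensor_vec (axis 1 1) (axis 1 1)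
      + (1 / sqrt 2) *\<^sub>R tensor_vec (axis 2 1) (axis 2 1)"
    by (simp add: CNOT_def matrix_vector_mult_def tensor_vec_def gate2_entries axis_def complex_eq_iff)
  then show "maximally_entangled (CNOT *v tensor_vec ?a ?b)"
    using on unfolding maximally_entangled_def schmidt_coeffs_def by auto
qed

text \<open>A Cartan form exists, so \<open>qp_extent_eq\<close> evaluates the extent; a sum of
  moduli of at least \<open>sqrt 2\<close> yields 2 * 2 - 1.\<close>

lemma qp_extent_ge_3:
  assumes "perfect_entangler U"
  shows "3 \<le> qp_extent U"
proof -
  have U: "unitary_mat U" using assms by (simp add: perfect_entangler_def)
  obtain \<theta>1 \<theta>2 \<theta>3 where cf: "has_cartan_form U \<theta>1 \<theta>2 \<theta>3"
    using unitary_local_equiv_cartan[OF U] cartan_gate_chamber local_equiv_trans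
    unfolding has_cartan_form_iff by metis
  let ?s = "\<Sum>j<4. cmod (cartan_coeff \<theta>1 \<theta>2 \<theta>3 j)"
  have "sqrt 2 \<le> ?s"
    using cf perfect_entangler_pauli_diag[OF assms]
    unfolding has_cartan_form_def cartan_gate_pauli_diag by blast
  then have "2 \<le> ?s\<^sup>2" using real_le_rsqrt sqrt_le_D by blast
  then show ?thesis by (simp add: qp_extent_eq[OF cf cartan_gate_pauli_diag])
qed

theorem corollary1:
  shows "(\<forall>U. perfect_entangler U \<longrightarrow> qp_extent U \<ge> 3)
    \<and> (perfect_entangler CNOT \<and> qp_extent CNOT = 3)
    \<and> qp_extent_min_PE = 3"
proof -
  have "qp_extent_min_PE = 3"
    unfolding qp_extent_min_PE_def
    by (rule Least_equality) (use perfect_entangler_CNOT qp_extent_CNOT qp_extent_ge_3 in auto)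
  then show ?thesis using perfect_entangler_CNOT qp_extent_CNOT qp_extent_ge_3 by blast
qed

end
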